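(* Let $n\ge2$, let $\Phi$ be the real affine root system of type $A_{2n}^{(2)}$, and let $\Psi$ be a maximal closed subroot system of $\Phi$. Then one of the following holds: (i) $\Psi=\widehat{A_J}$, the lift of $A_J$ in $\Phi$, for some $J\subsetneq I_n$; or (ii) $\Psi=\Psi_I(A_{2n}^{(2)})$ for some $I\subseteq I_n$; or (iii) there exist an odd prime number $n_s$ and a $\mathbb Z$-linear function $p:\mathrm{Gr}(\Phi)_s\cup\mathrm{Gr}(\Phi)_{\mathrm{im}}\to\tfrac12\mathbb Z$ with $p_{\epsilon_i}\in\tfrac12+\mathbb Z$ for all $i\in I_n$, satisfying $p_\beta-\langle\beta,\alpha^\vee\rangle p_\alpha=p_{\mathbf s_\alpha(\beta)}$ for all $\alpha,\beta$ in its domain, such that $\Psi=\Psi(p,n_s)$, where $$\Psi(p,n_s)=\{\pm(\epsilon_i+(p_{\epsilon_i}+rn_s)\delta),\ \pm(2\epsilon_i+(2p_{\epsilon_i}+n_s+2rn_s)\delta):i\in I_n,\ r\in\mathbb Z\}\cup\{\pm\epsilon_i\pm\epsilon_j+(\pm p_{\epsilon_i}\pm p_{\epsilon_j}+rn_s)\delta:i\neq j\in I_n,\ r\in\mathbb Z\}$$ (in the last set the signs of $p_{\epsilon_i},p_{\epsilon_j}$ are those of $\epsilon_i,\epsilon_j$). Conversely, all the subroot systems in (i), (ii), (iii) are maximal closed subroot systems of $\Phi$.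
   Context: $I_n=\{1,\dots,n\}$; $\epsilon_1,\dots,\epsilon_n$ are orthonormal and $\delta$ is a vector linearly independent of them with $(\delta,\cdot)=0$. $$\Phi=\{\pm\epsilon_i+(r+\tfrac12)\delta,\ \pm2\epsilon_i+2r\delta,\ \pm\epsilon_i\pm\epsilon_j+r\delta:1\le i\ne j\le n,\ r\in\mathbb Z\},$$ $\mathrm{Gr}(\Phi)=\{\pm\epsilon_i,\pm2\epsilon_i,\pm\epsilon_i\pm\epsilon_j:i\ne j\}$ (type $BC_n$), with short roots $\mathrm{Gr}(\Phi)_s=\{\pm\epsilon_i\}$ and intermediate roots $\mathrm{Gr}(\Phi)_{\mathrm{im}}=\{\pm\epsilon_i\pm\epsilon_j:i\neq j\}$. A function on a set of roots is $\mathbb Z$-linear if it is the restriction of an additive homomorphism from the lattice spanned by that set. For $J\subsetneq I_n$, $$A_J=\{\pm2\epsilon_i,\ \pm\epsilon_s\pm\epsilon_t:i\in I_n\setminus J,\ s\neq t\in I_n\setminus J\}\cup\{\pm2\epsilon_j,\ \pm\epsilon_j,\ \pm\epsilon_k\pm\epsilon_\ell:j\in J,\ k\ne\ell\in J\},$$ and its lift is $\widehat{A_J}=\{\alpha+r\delta\in\Phi:\alpha\in A_J\}$. For $I\subseteq I_n$ and $c\in\{\tfrac12,\tfrac32\}$ let $$\Psi^+(I,c)=\{\epsilon_i+(2r+c)\delta,\ (\epsilon_k+\epsilon_\ell)+(2r+1)\delta,\ (\epsilon_k-\epsilon_\ell)+2r\delta:i,k,\ell\in I,\ k\ne\ell,\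 r\in\mathbb Z\},$$ $$\Psi^+(I,0,1)=\{(\epsilon_k+\epsilon_\ell)+2r\delta,\ (\epsilon_k-\epsilon_\ell)+(2r+1)\delta:k\in I,\ \ell\in I_n\setminus I,\ r\in\mathbb Z\},$$ and let $\Psi_I(A_{2n}^{(2)})=P\cup(-P)$ with $P=\Psi^+(I,\tfrac12)\cup\Psi^+(I,0,1)\cup\Psi^+(I_n\setminus I,\tfrac32)$. With $\langle\beta,\alpha^\vee\rangle=2(\beta,\alpha)/(\alpha,\alpha)$ and $\mathbf s_\alpha(\beta)=\beta-\langle\beta,\alpha^\vee\rangle\alpha$, a non-empty subset $\Psi\subseteq\Phi$ is a subroot system if $\mathbf s_\alpha(\beta)\in\Psi$ for all $\alpha,\beta\in\Psi$; it is closed if $\alpha,\beta\in\Psi$, $\alpha+\beta\in\Phi$ imply $\alpha+\beta\in\Psi$. A maximal closed subroot system of $\Phi$ is a proper closed subroot system $\Psi$ such that $\Psi\subseteq\Delta\subsetneq\Phi$ with $\Delta$ a closed subroot system implies $\Delta=\Psi$. *)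

theory Defs
  imports
    "HOL-Analysis.Analysis"
    "HOL-Computational_Algebra.Group_Closure"
    "HOL-Computational_Algebra.Primes"
begin

section \<open>Subroot systems with respect to a symmetric bilinear form\<close>

definition pairing :: "('v::real_vector \<Rightarrow> 'v \<Rightarrow> real) \<Rightarrow> 'v \<Rightarrow> 'v \<Rightarrow> real"
  where "pairing form \<beta> \<alpha> = 2 * form \<beta> \<alpha> / form \<alpha> \<alpha>"

definition reflection :: "('v::real_vector \<Rightarrow> 'v \<Rightarrow> real) \<Rightarrow> 'v \<Rightarrow> 'v \<Rightarrow> 'v"
  where "reflection form \<alpha> \<beta> = \<beta> - pairing form \<beta> \<alpha> *\<^sub>R \<alpha>"

definition subroot_system :: "('v::real_vector \<Rightarrow> 'v \<Rightarrow> real) \<Rightarrow> 'v set \<Rightarrow> 'v set \<Rightarrow> bool"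
  where "subroot_system form \<Phi> \<Psi> \<longleftrightarrow>
    \<Psi> \<noteq> {} \<and> \<Psi> \<subseteq> \<Phi> \<and> (\<forall>\<alpha>\<in>\<Psi>. \<forall>\<beta>\<in>\<Psi>. reflection form \<alpha> \<beta> \<in> \<Psi>)"

definition closed_subroot_system :: "('v::real_vector \<Rightarrow> 'v \<Rightarrow> real) \<Rightarrow> 'v set \<Rightarrow> 'v set \<Rightarrow> bool"
  where "closed_subroot_system form \<Phi> \<Psi> \<longleftrightarrow>
    subroot_system form \<Phi> \<Psi> \<and> (\<forall>\<alpha>\<in>\<Psi>. \<forall>\<beta>\<in>\<Psi>. \<alpha> + \<beta> \<in> \<Phi> \<longrightarrow> \<alpha> + \<beta> \<in> \<Psi>)"

definition maximal_closed_subroot_system ::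
    "('v::real_vector \<Rightarrow> 'v \<Rightarrow> real) \<Rightarrow> 'v set \<Rightarrow> 'v set \<Rightarrow> bool"
  where "maximal_closed_subroot_system form \<Phi> \<Psi> \<longleftrightarrow>
    closed_subroot_system form \<Phi> \<Psi> \<and> \<Psi> \<noteq> \<Phi> \<and>
    (\<forall>\<Delta>. closed_subroot_system form \<Phi> \<Delta> \<and> \<Psi> \<subseteq> \<Delta> \<and> \<Delta> \<subset> \<Phi> \<longrightarrow> \<Delta> = \<Psi>)"

text \<open>The lattice spanned by \<open>S\<close> is the additive subgroup \<open>group_closure S\<close> it generates. Only the
  values of \<open>p\<close> on \<open>S\<close> matter.\<close>

definition Z_linear_on :: "'v::real_vector set \<Rightarrow> ('v \<Rightarrow> real) \<Rightarrow> bool"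
  where "Z_linear_on S p \<longleftrightarrow>
    (\<exists>f :: 'v \<Rightarrow> real.
      (\<forall>x\<in>group_closure S. \<forall>y\<in>group_closure S. f (x + y) = f x + f y) \<and> (\<forall>x\<in>S. p x = f x))"


section \<open>The real affine root system of type \<open>A\<^bsub>2n\<^esub>\<^bsup>(2)\<^esup>\<close>\<close>

text \<open>The ambient space is any real vector space with a symmetric bilinear form; \<open>eps i\<close> is only
  relevant for \<open>1 \<le> i \<le> n\<close>. One instance, with \<open>n = CARD('n)\<close>, is \<open>real ^ 'n \<times> real\<close> with
  the form \<open>\<lambda>x y. fst x \<bullet> fst y\<close> and \<open>delta = (0, 1)\<close>.\<close>

locale affine_setting =
  fixes n :: nat
    and form :: "'v::real_vector \<Rightarrow> 'v \<Rightarrow> real"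
    and eps :: "nat \<Rightarrow> 'v"
    and delta :: 'v
  assumes form_bilinear: "bilinear form"
    and form_sym: "\<And>x y. form x y = form y x"
    and eps_orthonormal:
      "\<And>i j. i \<in> {1..n} \<Longrightarrow> j \<in> {1..n} \<Longrightarrow> form (eps i) (eps j) = (if i = j then 1 else 0)"
    and delta_independent: "delta \<notin> span (eps ` {1..n})"
    and form_delta: "\<And>x. form delta x = 0"

abbreviation signs :: "real set"
  where "signs \<equiv> {1, -1}"

definition Phi :: "nat \<Rightarrow> (nat \<Rightarrow> 'v::real_vector) \<Rightarrow> 'v \<Rightarrow> 'v set"
  where "Phi n eps delta =
    {s *\<^sub>R eps i + (of_int r + 1/2) *\<^sub>R delta | s i (r::int). s \<in> signs \<and> i \<in> {1..n}} \<union>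
    {(2 * s) *\<^sub>R eps i + (2 * of_int r) *\<^sub>R delta | s i (r::int). s \<in> signs \<and> i \<in> {1..n}} \<union>
    {s *\<^sub>R eps i + t *\<^sub>R eps j + of_int r *\<^sub>R delta | s t i j (r::int).
      s \<in> signs \<and> t \<in> signs \<and> i \<in> {1..n} \<and> j \<in> {1..n} \<and> i \<noteq> j}"

definition Gr_short :: "nat \<Rightarrow> (nat \<Rightarrow> 'v::real_vector) \<Rightarrow> 'v set"
  where "Gr_short n eps = {s *\<^sub>R eps i | s i. s \<in> signs \<and> i \<in> {1..n}}"

definition Gr_im :: "nat \<Rightarrow> (nat \<Rightarrow> 'v::real_vector) \<Rightarrow> 'v set"
  where "Gr_im n eps = {s *\<^sub>R eps i + t *\<^sub>R eps j | s t i j.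
    s \<in> signs \<and> t \<in> signs \<and> i \<in> {1..n} \<and> j \<in> {1..n} \<and> i \<noteq> j}"

definition A_J :: "nat \<Rightarrow> (nat \<Rightarrow> 'v::real_vector) \<Rightarrow> nat set \<Rightarrow> 'v set"
  where "A_J n eps J =
    {(2 * s) *\<^sub>R eps i | s i. s \<in> signs \<and> i \<in> {1..n} - J} \<union>
    {s *\<^sub>R eps i + t *\<^sub>R eps j | s t i j.
      s \<in> signs \<and> t \<in> signs \<and> i \<in> {1..n} - J \<and> j \<in> {1..n} - J \<and> i \<noteq> j} \<union>
    {(2 * s) *\<^sub>R eps j | s j. s \<in> signs \<and> j \<in> J} \<union>
    {s *\<^sub>R eps j | s j. s \<in> signs \<and> j \<in> J} \<union>
    {s *\<^sub>R eps k + t *\<^sub>R eps l | s t k l.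
      s \<in> signs \<and> t \<in> signs \<and> k \<in> J \<and> l \<in> J \<and> k \<noteq> l}"

definition lift :: "nat \<Rightarrow> (nat \<Rightarrow> 'v::real_vector) \<Rightarrow> 'v \<Rightarrow> 'v set \<Rightarrow> 'v set"
  where "lift n eps delta A = {\<alpha> + r *\<^sub>R delta | \<alpha> r. \<alpha> \<in> A \<and> \<alpha> + r *\<^sub>R delta \<in> Phi n eps delta}"

definition Psi_plus :: "(nat \<Rightarrow> 'v::real_vector) \<Rightarrow> 'v \<Rightarrow> nat set \<Rightarrow> real \<Rightarrow> 'v set"
  where "Psi_plus eps delta I c =
    {eps i + (2 * of_int r + c) *\<^sub>R delta | i (r::int). i \<in> I} \<union>
    {eps k + eps l + (2 * of_int r + 1) *\<^sub>R delta | k l (r::int). k \<in> I \<and> l \<in> I \<and> k \<noteq> l} \<union>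
    {eps k - eps l + (2 * of_int r) *\<^sub>R delta | k l (r::int). k \<in> I \<and> l \<in> I \<and> k \<noteq> l}"

definition Psi_plus01 :: "nat \<Rightarrow> (nat \<Rightarrow> 'v::real_vector) \<Rightarrow> 'v \<Rightarrow> nat set \<Rightarrow> 'v set"
  where "Psi_plus01 n eps delta I =
    {eps k + eps l + (2 * of_int r) *\<^sub>R delta | k l (r::int). k \<in> I \<and> l \<in> {1..n} - I} \<union>
    {eps k - eps l + (2 * of_int r + 1) *\<^sub>R delta | k l (r::int). k \<in> I \<and> l \<in> {1..n} - I}"

definition Psi_I :: "nat \<Rightarrow> (nat \<Rightarrow> 'v::real_vector) \<Rightarrow> 'v \<Rightarrow> nat set \<Rightarrow> 'v set"
  where "Psi_I n eps delta I =
    (let P = Psi_plus eps delta I (1/2) \<union> Psi_plus01 n eps delta I \<union>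
             Psi_plus eps delta ({1..n} - I) (3/2)
     in P \<union> uminus ` P)"

definition admissible_p ::
    "nat \<Rightarrow> ('v::real_vector \<Rightarrow> 'v \<Rightarrow> real) \<Rightarrow> (nat \<Rightarrow> 'v) \<Rightarrow> ('v \<Rightarrow> real) \<Rightarrow> bool"
  where "admissible_p n form eps p \<longleftrightarrow>
    (let D = Gr_short n eps \<union> Gr_im n eps in
      Z_linear_on D p \<and>
      (\<forall>\<alpha>\<in>D. 2 * p \<alpha> \<in> \<int>) \<and>
      (\<forall>i\<in>{1..n}. p (eps i) - 1/2 \<in> \<int>) \<and>
      (\<forall>\<alpha>\<in>D. \<forall>\<beta>\<in>D. p \<beta> - pairing form \<beta> \<alpha> * p \<alpha> = p (reflection form \<alpha> \<beta>)))"

definition Psi_p :: "nat \<Rightarrow> (nat \<Rightarrow> 'v::real_vector) \<Rightarrow> 'v \<Rightarrow> ('v \<Rightarrow> real) \<Rightarrow> nat \<Rightarrow> 'v set"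
  where "Psi_p n eps delta p m =
    {s *\<^sub>R (eps i + (p (eps i) + of_int r * of_nat m) *\<^sub>R delta) | s i (r::int).
      s \<in> signs \<and> i \<in> {1..n}} \<union>
    {s *\<^sub>R (2 *\<^sub>R eps i + (2 * p (eps i) + of_nat m + 2 * of_int r * of_nat m) *\<^sub>R delta) | s i (r::int).
      s \<in> signs \<and> i \<in> {1..n}} \<union>
    {s *\<^sub>R eps i + t *\<^sub>R eps j + (s * p (eps i) + t * p (eps j) + of_int r * of_nat m) *\<^sub>R delta
      | s t i j (r::int).
      s \<in> signs \<and> t \<in> signs \<and> i \<in> {1..n} \<and> j \<in> {1..n} \<and> i \<noteq> j}"

end

theory Submission
  imports Defs
begin

text \<open>Each of the subroot systems listed in the theorem is cut out of \<open>\<Phi>\<close> by one congruence: it has the form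
  \<open>{x \<in> \<Phi>. f x \<in> m\<int>}\<close> for a linear functional \<open>f\<close> and a natural number \<open>m\<close>. All such sets are closed
  subroot systems, because \<open>f\<close> is additive and because the numbers \<open>\<langle>\<beta>, \<alpha>\<^sup>\<or>\<rangle>\<close> are integers for roots
  \<open>\<alpha>, \<beta>\<close> (\<open>closed_congruent_roots\<close>). The lift of \<open>A\<^sub>J\<close> is the case \<open>m = 2\<close> where \<open>f\<close> adds up the
  \<open>\<epsilon>\<^sub>i\<close>-coordinates with \<open>i \<notin> J\<close>. The other two families are the cases where \<open>m\<close> is a prime (\<open>m = 2\<close> for
  \<open>\<Psi>\<^sub>I\<close>, and \<open>m = n\<^sub>s\<close> for \<open>\<Psi>(p, n\<^sub>s)\<close>) and \<open>f x\<close> is the \<open>\<delta>\<close>-coordinate of \<open>x\<close> minus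
  \<open>\<Sum>\<^sub>i p\<^sub>i (x, \<epsilon>\<^sub>i)\<close> with half-integers \<open>p\<^sub>i\<close>; the number \<open>f x\<close> is then an integer for every root.

  The core is \<open>closed_with_all_short_directions\<close>. Let \<open>\<Delta>\<close> be closed and contain some
  \<open>\<epsilon>\<^sub>i + p\<^sub>i\<delta>\<close> for each \<open>i\<close>. Adding a short root in an orthogonal direction and subtracting another one
  carries the shifts that occur in one short direction into every other short direction (here
  \<open>n \<ge> 2\<close> enters) and adds them, so the shifts form one and the same subgroup \<open>m\<int>\<close> of \<open>\<int>\<close> for all directions.
  Each long or intermediate root is a sum of two short roots, hence \<open>\<Delta>\<close> is the set cut out by \<open>f\<close> and \<open>m\<close>.

  Classification: let \<open>\<Psi>\<close> be maximal. If it lacks short roots in some direction, it lies in the lift of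
  \<open>A\<^sub>J\<close>, where \<open>J\<close> is the set of directions that do occur, since an intermediate root with just
  one index in \<open>J\<close> would produce a short root outside \<open>J\<close> (\<open>closed_subset_lift\<close>). Otherwise \<open>\<Psi>\<close> is the set
  for some \<open>m \<noteq> 1\<close>, and it lies in the set for any prime divisor of \<open>m\<close>. Maximality turns both inclusions
  into equalities.

  Converse: a proper closed system that contains the set for a prime \<open>q\<close> belongs to a divisor \<open>m \<noteq> 1\<close>
  of \<open>q\<close>, so it is equal to that set. A closed system that contains the lift of \<open>A\<^sub>J\<close> and has all short
  directions has \<open>m = 1\<close>, because it contains \<open>2\<epsilon>\<^sub>i\<close> for some \<open>i \<notin> J\<close> and \<open>2p\<^sub>i\<close> is odd; one that lacks a
  short direction lies itself in such a lift, and comparing the index sets gives equality.\<close>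

section \<open>Unit vectors and coordinates\<close>

context affine_setting
begin

abbreviation "\<Phi> \<equiv> Phi n eps delta"

text \<open>The signed basis vectors: every root is \<open>u\<close>, \<open>2u\<close> or \<open>u + v\<close> with orthogonal units \<open>u, v\<close>, up to a
  multiple of \<open>\<delta>\<close>, and reflections permute the units up to multiples of \<open>\<delta>\<close>. This turns most sign
  distinctions into statements on units.\<close>

abbreviation "units \<equiv> Gr_short n eps"

lemma form_delta_right [simp]: "form x delta = 0"
  using form_delta form_sym by metis

lemma form_linear_simps [simp]:
  "form (x + y) z = form x z + form y z" "form z (x + y) = form z x + form z y"
  "form (x - y) z = form x z - form y z" "form z (x - y) = form z x - form z y"
  "form (c *\<^sub>R x) z = c * form x z" "form z (c *\<^sub>R x) = c * form z x"
  "form (- x) z = - form x z" "form z (- x) = - form z x"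
  "form delta z = 0"
  using form_bilinear
  by (auto simp: bilinear_ladd bilinear_radd bilinear_lsub bilinear_rsub bilinear_lmul bilinear_rmul
      bilinear_lneg bilinear_rneg form_delta)

lemma eps_unit: "i \<in> {1..n} \<Longrightarrow> eps i \<in> units"
  unfolding Gr_short_def by (force intro: exI[of _ "1::real"])

lemma unit_cases:
  assumes "u \<in> units"
  obtains i where "i \<in> {1..n}" "u = eps i" | i where "i \<in> {1..n}" "u = - eps i"
  using assms unfolding Gr_short_def by auto

lemma uminus_unit: "u \<in> units \<Longrightarrow> - u \<in> units"
proof -
  assume "u \<in> units"
  then obtain s i where "s \<in> signs" "i \<in> {1..n}" "u = s *\<^sub>R eps i"
    unfolding Gr_short_def by blast
  then have "- s \<in> signs" "i \<in> {1..n}" "- u = (- s) *\<^sub>R eps i" by auto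
  then show "- u \<in> units" unfolding Gr_short_def by blast
qed

lemma form_unit_self [simp]: "u \<in> units \<Longrightarrow> form u u = 1"
  by (erule unit_cases) (auto simp: eps_orthonormal)

lemma two_units_cases:
  assumes "u \<in> units" "v \<in> units"
  obtains "v = u" | "v = - u" | "form u v = 0" "form v u = 0"
proof -
  obtain i where i: "i \<in> {1..n}" "u = eps i \<or> u = - eps i"
    using assms(1) by (auto elim: unit_cases)
  obtain j where j: "j \<in> {1..n}" "v = eps j \<or> v = - eps j"
    using assms(2) by (auto elim: unit_cases)
  show ?thesis
  proof (cases "i = j")
    case True
    then have "v = u \<or> v = - u" using i j by auto
    then show ?thesis using that by blast
  next
    case False
    then have "form u v = 0" "form v u = 0" using i j by (auto simp: eps_orthonormal)
    then show ?thesis by (rule that)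
  qed
qed

lemma orthogonal_unit_exists:
  assumes "n \<ge> 2" "u \<in> units"
  obtains v where "v \<in> units" "form u v = 0"
proof -
  obtain i where i: "i \<in> {1..n}" "u = eps i \<or> u = - eps i"
    using assms(2) by (auto elim: unit_cases)
  define j where "j = (if i = 1 then 2 else 1::nat)"
  have "j \<in> {1..n}" "i \<noteq> j" using assms(1) i by (auto simp: j_def)
  then have "eps j \<in> units" "form u (eps j) = 0" using i by (auto simp: eps_unit eps_orthonormal)
  then show ?thesis by (rule that)
qed

lemma delta_coordinate_exists:
  "\<exists>d::'v \<Rightarrow> real. linear d \<and> d delta = 1 \<and> (\<forall>i\<in>{1..n}. d (eps i) = 0)"
proof -
  obtain B where B: "B \<subseteq> eps ` {1..n}" "independent B" "eps ` {1..n} \<subseteq> span B"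
    by (rule maximal_independent_subset)
  have sp: "delta \<notin> span B" using delta_independent span_mono[OF B(1)] by auto
  then have "independent (insert delta B)" using B(2) by (rule independent_insertI)
  from linear_independent_extend[OF this, of "\<lambda>x. if x = delta then 1 else 0"]
  obtain d :: "'v \<Rightarrow> real" where d: "linear d"
      "\<forall>x\<in>insert delta B. d x = (if x = delta then 1 else 0)" by auto
  have "\<And>b. b \<in> B \<Longrightarrow> d b = 0" using d(2) sp span_base by force
  then have "d x = 0" if "x \<in> span B" for x
    using linear_eq_0_on_span[OF d(1)] that by blast
  then have "\<forall>i\<in>{1..n}. d (eps i) = 0" using B(3) by blast
  moreover have "d delta = 1" using d(2) by simp
  ultimately show ?thesis using d(1) by blast
qed

text \<open>The choice determines this functional only on the span of \<open>\<delta>\<close> and the \<open>\<epsilon>\<^sub>i\<close>, which contains all roots.\<close>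

definition delta_coord :: "'v \<Rightarrow> real"
  where "delta_coord = (SOME d. linear d \<and> d delta = 1 \<and> (\<forall>i\<in>{1..n}. d (eps i) = 0))"

lemma delta_coord:
  shows linear_delta_coord: "linear delta_coord"
    and delta_coord_delta [simp]: "delta_coord delta = 1"
    and delta_coord_eps [simp]: "\<And>i. i \<in> {1..n} \<Longrightarrow> delta_coord (eps i) = 0"
  using someI_ex[OF delta_coordinate_exists] unfolding delta_coord_def by auto

lemma delta_coord_simps [simp]:
  "delta_coord (x + y) = delta_coord x + delta_coord y"
  "delta_coord (x - y) = delta_coord x - delta_coord y"
  "delta_coord (c *\<^sub>R x) = c * delta_coord x"
  "delta_coord (- x) = - delta_coord x"
  using linear_delta_coord by (auto simp: linear_add linear_diff linear_scale linear_neg)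

lemma delta_coord_unit [simp]: "u \<in> units \<Longrightarrow> delta_coord u = 0"
  by (erule unit_cases) auto

section \<open>Roots in terms of units\<close>

lemma Phi_cases [consumes 1, case_names short long intermediate]:
  assumes "x \<in> \<Phi>"
  obtains s i r where "s \<in> signs" "i \<in> {1..n}" "x = s *\<^sub>R eps i + (of_int r + 1/2) *\<^sub>R delta"
    | s i r where "s \<in> signs" "i \<in> {1..n}" "x = (2 * s) *\<^sub>R eps i + (2 * of_int r) *\<^sub>R delta"
    | s t i j r where "s \<in> signs" "t \<in> signs" "i \<in> {1..n}" "j \<in> {1..n}" "i \<noteq> j"
        "x = s *\<^sub>R eps i + t *\<^sub>R eps j + of_int r *\<^sub>R delta"
  using assms unfolding Phi_def by (elim UnE CollectE exE conjE) (rule that; assumption)+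

text \<open>The sign-free form of the three kinds of roots, in which \<open>a\<close>, \<open>b\<close> and \<open>c\<close> range over a coset of \<open>\<int>\<close>.\<close>

lemma root_cases [consumes 1, case_names short long intermediate]:
  assumes "x \<in> \<Phi>"
  obtains u a where "u \<in> units" "a - 1/2 \<in> \<int>" "x = u + a *\<^sub>R delta"
  | u b where "u \<in> units" "b \<in> \<int>" "x = 2 *\<^sub>R u + (2 * b) *\<^sub>R delta"
  | u v c where "u \<in> units" "v \<in> units" "form u v = 0" "c \<in> \<int>" "x = u + v + c *\<^sub>R delta"
  using assms
proof (cases rule: Phi_cases)
  case (short s i r)
  then have "s *\<^sub>R eps i \<in> units" unfolding Gr_short_def by blast
  then show ?thesis by (rule that(1)[OF _ _ short(3)]) simp
next
  case (long s i r)
  then have "s *\<^sub>R eps i \<in> units" unfolding Gr_short_def by blast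
  then show ?thesis by (rule that(2)[OF _ Ints_of_int[of r]]) (simp add: long)
next
  case (intermediate s t i j r)
  then have u: "s *\<^sub>R eps i \<in> units" and v: "t *\<^sub>R eps j \<in> units"
    unfolding Gr_short_def by blast+
  have "form (s *\<^sub>R eps i) (t *\<^sub>R eps j) = 0" using intermediate by (simp add: eps_orthonormal)
  then show ?thesis by (rule that(3)[OF u v _ Ints_of_int intermediate(6)])
qed

text \<open>The kind of a root can be read off from its norm, which is 1, 4 or 2. A short root is thus short in every
  presentation, and its \<open>\<delta>\<close>-coordinate must be a half-integer.\<close>

lemma short_root_iff:
  assumes "u \<in> units" shows "u + a *\<^sub>R delta \<in> \<Phi> \<longleftrightarrow> a - 1/2 \<in> \<int>"
proof
  assume "u + a *\<^sub>R delta \<in> \<Phi>"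
  then show "a - 1/2 \<in> \<int>"
  proof (cases rule: root_cases)
    case (short v b)
    have "a = delta_coord (u + a *\<^sub>R delta)" using assms by simp
    also have "\<dots> = b" unfolding short(3) using short(1) by simp
    finally show ?thesis using short(2) by simp
  next
    case (long v b)
    have "1 = form (u + a *\<^sub>R delta) (u + a *\<^sub>R delta)" using assms by simp
    also have "\<dots> = 4" unfolding long(3) using long(1) by simp
    finally show ?thesis by simp
  next
    case (intermediate v w c)
    have "form w v = 0" using intermediate(3) form_sym by metis
    have "1 = form (u + a *\<^sub>R delta) (u + a *\<^sub>R delta)" using assms by simp
    also have "\<dots> = 2" unfolding intermediate(5) using intermediate(1-3) \<open>form w v = 0\<close> by simp
    finally show ?thesis by simp
  qed
next
  assume "a - 1/2 \<in> \<int>"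
  then obtain r :: int where "a = of_int r + 1/2" by (auto elim!: Ints_cases simp: algebra_simps)
  moreover obtain s i where "s \<in> signs" "i \<in> {1..n}" "u = s *\<^sub>R eps i"
    using assms unfolding Gr_short_def by blast
  ultimately show "u + a *\<^sub>R delta \<in> \<Phi>" unfolding Phi_def by blast
qed

lemma long_rootI:
  assumes "u \<in> units" "b \<in> \<int>" shows "2 *\<^sub>R u + (2 * b) *\<^sub>R delta \<in> \<Phi>"
proof -
  obtain s i where "s \<in> signs" "i \<in> {1..n}" "u = s *\<^sub>R eps i"
    using assms unfolding Gr_short_def by blast
  moreover from this have "2 *\<^sub>R u = (2 * s) *\<^sub>R eps i" by simp
  moreover obtain r :: int where "b = of_int r" using assms by (auto elim: Ints_cases)
  ultimately have "2 *\<^sub>R u + (2 * b) *\<^sub>R delta = (2 * s) *\<^sub>R eps i + (2 * of_int r) *\<^sub>R delta"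
    "s \<in> signs \<and> i \<in> {1..n}" by simp_all
  then show ?thesis unfolding Phi_def by blast
qed

lemma intermediate_rootI:
  assumes "u \<in> units" "v \<in> units" "form u v = 0" "c \<in> \<int>"
  shows "u + v + c *\<^sub>R delta \<in> \<Phi>"
proof -
  obtain s i where u: "s \<in> signs" "i \<in> {1..n}" "u = s *\<^sub>R eps i"
    using assms unfolding Gr_short_def by auto
  obtain t j where v: "t \<in> signs" "j \<in> {1..n}" "v = t *\<^sub>R eps j"
    using assms unfolding Gr_short_def by auto
  have "i \<noteq> j" using u v assms(3) by (auto simp: eps_orthonormal)
  moreover obtain r :: int where "c = of_int r" using assms by (auto elim: Ints_cases)
  ultimately show ?thesis using u v unfolding Phi_def by blast
qed

lemma root_norm_pos: "\<alpha> \<in> \<Phi> \<Longrightarrow> form \<alpha> \<alpha> > 0"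
proof (erule root_cases)
  fix u v :: 'v and c
  assume *: "u \<in> units" "v \<in> units" "form u v = 0" "\<alpha> = u + v + c *\<^sub>R delta"
  then have "form v u = 0" using form_sym by metis
  with * show "form \<alpha> \<alpha> > 0" by simp
qed simp_all

section \<open>Reflections\<close>

lemma reflection_simps:
  "reflection form \<alpha> (x + y) = reflection form \<alpha> x + reflection form \<alpha> y"
  "reflection form \<alpha> (c *\<^sub>R x) = c *\<^sub>R reflection form \<alpha> x"
  "reflection form \<alpha> delta = delta"
  by (auto simp: reflection_def pairing_def algebra_simps add_divide_distrib)

lemma form_reflection:
  assumes "\<alpha> \<in> \<Phi>"
  shows "form (reflection form \<alpha> x) (reflection form \<alpha> y) = form x y"
  using root_norm_pos[OF assms] form_sym[of \<alpha> x] form_sym[of \<alpha> y]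
  by (simp add: reflection_def pairing_def field_simps)

lemma reflection_self: "\<alpha> \<in> \<Phi> \<Longrightarrow> reflection form \<alpha> \<alpha> = - \<alpha>"
  using root_norm_pos[of \<alpha>] by (simp add: reflection_def pairing_def algebra_simps scaleR_2)

lemma half_integer_double: "2 * a \<in> \<int>" if "a - 1/2 \<in> \<int>" for a :: real
proof -
  have "2 * (a - 1/2) + 1 \<in> \<int>" using that by (intro Ints_add Ints_mult) simp_all
  then show ?thesis by (simp add: algebra_simps)
qed

lemma half_integer_add: "a + b \<in> \<int>" if "a - 1/2 \<in> \<int>" "b - 1/2 \<in> \<int>" for a b :: real
proof -
  have "(a - 1/2) + (b - 1/2) + 1 \<in> \<int>" by (intro Ints_add that Ints_1)
  then show ?thesis by simp
qed

lemma half_integer_diff: "a - b \<in> \<int>" if "a - 1/2 \<in> \<int>" "b - 1/2 \<in> \<int>" for a b :: real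
  using Ints_diff[OF that] by simp

text \<open>Short and long roots act in the same way on units: they negate one axis. The translation part \<open>2a/c\<close>
  is twice a half-integer when \<open>c = 1\<close>, and an even integer when \<open>c = 2\<close>.\<close>

lemma reflect_unit_along_axis:
  assumes u: "u \<in> units" and w: "w \<in> units" and \<alpha>: "\<alpha> = c *\<^sub>R u + a *\<^sub>R delta"
    and c: "c = 1 \<or> c = 2" "2 * a / c \<in> \<int>"
  shows "pairing form w \<alpha> \<in> \<int> \<and>
    (\<exists>w'\<in>units. \<exists>b\<in>\<int>. reflection form \<alpha> w = w' + b *\<^sub>R delta)"
  using u w
proof (cases rule: two_units_cases)
  case 1
  have "reflection form \<alpha> w = - w + (- (2 * a / c)) *\<^sub>R delta" "pairing form w \<alpha> = 2 / c"
    using u c \<alpha> 1 by (auto simp: reflection_def pairing_def algebra_simps scaleR_2)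
  moreover have "- (2 * a / c) \<in> \<int>" "2 / c \<in> \<int>" using c by auto
  ultimately show ?thesis using uminus_unit[OF w] by metis
next
  case 2
  have "reflection form \<alpha> w = - w + (2 * a / c) *\<^sub>R delta" "pairing form w \<alpha> = - (2 / c)"
    using u c \<alpha> 2 by (auto simp: reflection_def pairing_def algebra_simps scaleR_2)
  moreover have "- (2 / c) \<in> \<int>" using c by auto
  ultimately show ?thesis using uminus_unit[OF w] c(2) by metis
next
  case 3
  have "reflection form \<alpha> w = w + 0 *\<^sub>R delta" "pairing form w \<alpha> = 0"
    using \<alpha> 3 by (auto simp: reflection_def pairing_def)
  then show ?thesis using w by (metis Ints_0)
qed

text \<open>An intermediate root with linear part \<open>u + v\<close> exchanges \<open>u\<close> with \<open>- v\<close>, up to a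
  multiple of \<open>\<delta>\<close>, and fixes the units orthogonal to both.\<close>

lemma reflect_unit:
  assumes "\<alpha> \<in> \<Phi>" "w \<in> units"
  shows "pairing form w \<alpha> \<in> \<int> \<and>
    (\<exists>w'\<in>units. \<exists>c\<in>\<int>. reflection form \<alpha> w = w' + c *\<^sub>R delta)"
  using assms(1)
proof (cases rule: root_cases)
  case (short u a)
  then show ?thesis
    using half_integer_double[OF short(2)] assms(2)
    by (intro reflect_unit_along_axis[of u w \<alpha> 1 a]) simp_all
next
  case (long u b)
  then show ?thesis
    using assms(2) by (intro reflect_unit_along_axis[of u w \<alpha> 2 "2 * b"]) simp_all
next
  case (intermediate u v c)
  have sym: "form v u = 0" using intermediate(3) form_sym by metis
  have pr: "pairing form w \<alpha> = form w u + form w v"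
    using intermediate sym by (simp add: pairing_def)
  have uv: "- u \<in> units" "- v \<in> units" "- c \<in> \<int>" "0 \<in> \<int>" using intermediate uminus_unit by auto
  have u: ?thesis if "w = u"
    using that pr intermediate uv
    by (auto simp: reflection_def intro!: bexI[of _ "- v"] bexI[of _ "- c"])
  have u': ?thesis if "w = - u"
    using that pr intermediate uv
    by (auto simp: reflection_def intro!: bexI[of _ v] bexI[of _ c])
  have v: ?thesis if "w = v"
    using that pr intermediate uv sym
    by (auto simp: reflection_def intro!: bexI[of _ "- u"] bexI[of _ "- c"])
  have v': ?thesis if "w = - v"
    using that pr intermediate uv sym
    by (auto simp: reflection_def intro!: bexI[of _ u] bexI[of _ c])
  have o: ?thesis if "form w u = 0" "form w v = 0"
  proof -
    have "reflection form \<alpha> w = w + 0 *\<^sub>R delta" "pairing form w \<alpha> = 0"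
      using that pr by (simp_all add: reflection_def)
    then show ?thesis using assms(2) by (metis Ints_0)
  qed
  show ?thesis
    using two_units_cases[OF intermediate(1) assms(2)] two_units_cases[OF intermediate(2) assms(2)]
      u u' v v' o by metis
qed

lemma pairing_root_integral:
  assumes "\<alpha> \<in> \<Phi>" "\<beta> \<in> \<Phi>" shows "pairing form \<beta> \<alpha> \<in> \<int>"
proof -
  have add: "pairing form (x + y) \<alpha> = pairing form x \<alpha> + pairing form y \<alpha>"
    and scale: "pairing form (c *\<^sub>R x) \<alpha> = c * pairing form x \<alpha>"
    and del: "pairing form delta \<alpha> = 0" for x y c
    by (auto simp: pairing_def algebra_simps add_divide_distrib)
  show ?thesis
    using assms(2) reflect_unit[OF assms(1)]
    by (cases rule: root_cases) (auto simp: add scale del)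
qed

text \<open>A reflection is linear, fixes \<open>\<delta>\<close> and preserves the form, so its effect on units determines the images of
  all three kinds of roots; the integral translations of the units preserve the conditions on
  \<open>\<delta>\<close>-coordinates.\<close>

lemma reflection_root:
  assumes "\<alpha> \<in> \<Phi>" "\<beta> \<in> \<Phi>" shows "reflection form \<alpha> \<beta> \<in> \<Phi>"
  using assms(2)
proof (cases rule: root_cases)
  case (short u a)
  then obtain u' c where u': "u' \<in> units" "c \<in> \<int>" "reflection form \<alpha> u = u' + c *\<^sub>R delta"
    using reflect_unit[OF assms(1)] by blast
  have "(a - 1/2) + c \<in> \<int>" using short u' by (intro Ints_add)
  then have "(c + a) - 1/2 \<in> \<int>" by (simp add: algebra_simps)
  then have "u' + (c + a) *\<^sub>R delta \<in> \<Phi>" using short_root_iff u' by blast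
  then show ?thesis using u' short by (simp add: reflection_simps algebra_simps)
next
  case (long u b)
  then obtain u' c where u': "u' \<in> units" "c \<in> \<int>" "reflection form \<alpha> u = u' + c *\<^sub>R delta"
    using reflect_unit[OF assms(1)] by blast
  have "2 *\<^sub>R u' + (2 * (c + b)) *\<^sub>R delta \<in> \<Phi>" using long u' by (intro long_rootI) auto
  then show ?thesis using u' long by (simp add: reflection_simps algebra_simps)
next
  case (intermediate u v b)
  obtain u' c where u': "u' \<in> units" "c \<in> \<int>" "reflection form \<alpha> u = u' + c *\<^sub>R delta"
    using reflect_unit[OF assms(1)] intermediate by blast
  obtain v' d where v': "v' \<in> units" "d \<in> \<int>" "reflection form \<alpha> v = v' + d *\<^sub>R delta"
    using reflect_unit[OF assms(1)] intermediate by blast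
  have "form u' v' = 0"
    using form_reflection[OF assms(1), of u v] u' v' intermediate by simp
  then have "u' + v' + (c + d + b) *\<^sub>R delta \<in> \<Phi>"
    using intermediate u' v' by (intro intermediate_rootI) auto
  then show ?thesis using u' v' intermediate by (simp add: reflection_simps algebra_simps)
qed

section \<open>Subsystems cut out by a congruence\<close>

definition congruent_roots :: "('v \<Rightarrow> real) \<Rightarrow> nat \<Rightarrow> 'v set"
  where "congruent_roots f m = {x \<in> \<Phi>. \<exists>k::int. f x = of_nat m * of_int k}"

lemma closed_congruent_roots:
  assumes f: "linear f" and ne: "congruent_roots f m \<noteq> {}"
  shows "closed_subroot_system form \<Phi> (congruent_roots f m)"
proof -
  have "reflection form \<alpha> \<beta> \<in> congruent_roots f m"
    if \<alpha>: "\<alpha> \<in> congruent_roots f m" and \<beta>: "\<beta> \<in> congruent_roots f m" for \<alpha> \<beta>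
  proof -
    have R: "\<alpha> \<in> \<Phi>" "\<beta> \<in> \<Phi>" using \<alpha> \<beta> by (auto simp: congruent_roots_def)
    obtain a b :: int where ab: "f \<alpha> = of_nat m * of_int a" "f \<beta> = of_nat m * of_int b"
      using \<alpha> \<beta> by (auto simp: congruent_roots_def)
    obtain k :: int where k: "pairing form \<beta> \<alpha> = of_int k"
      using pairing_root_integral[OF R] by (auto elim: Ints_cases)
    have "f (reflection form \<alpha> \<beta>) = of_nat m * of_int (b - k * a)"
      unfolding reflection_def using f ab k
      by (simp add: linear_diff linear_scale algebra_simps)
    then show ?thesis using reflection_root[OF R] unfolding congruent_roots_def by blast
  qed
  moreover have "\<alpha> + \<beta> \<in> congruent_roots f m"
    if \<alpha>: "\<alpha> \<in> congruent_roots f m" and \<beta>: "\<beta> \<in> congruent_roots f m"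
      and R: "\<alpha> + \<beta> \<in> \<Phi>" for \<alpha> \<beta>
  proof -
    obtain a b :: int where ab: "f \<alpha> = of_nat m * of_int a" "f \<beta> = of_nat m * of_int b"
      using \<alpha> \<beta> by (auto simp: congruent_roots_def)
    have "f (\<alpha> + \<beta>) = of_nat m * of_int (a + b)"
      using f ab by (simp add: linear_add algebra_simps)
    then show ?thesis using R unfolding congruent_roots_def by blast
  qed
  ultimately show ?thesis
    using ne unfolding closed_subroot_system_def subroot_system_def
    by (auto simp: congruent_roots_def)
qed

lemma closedD:
  assumes "closed_subroot_system form \<Phi> \<Delta>"
  shows "x \<in> \<Delta> \<Longrightarrow> x \<in> \<Phi>" "x \<in> \<Delta> \<Longrightarrow> - x \<in> \<Delta>"
    "x \<in> \<Delta> \<Longrightarrow> y \<in> \<Delta> \<Longrightarrow> x + y \<in> \<Phi> \<Longrightarrow> x + y \<in> \<Delta>"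
    "x \<in> \<Delta> \<Longrightarrow> y \<in> \<Delta> \<Longrightarrow> x - y \<in> \<Phi> \<Longrightarrow> x - y \<in> \<Delta>"
proof -
  show 1: "x \<in> \<Delta> \<Longrightarrow> x \<in> \<Phi>" for x
    using assms unfolding closed_subroot_system_def subroot_system_def by auto
  show 2: "x \<in> \<Delta> \<Longrightarrow> - x \<in> \<Delta>" for x
    using assms 1 reflection_self[of x] unfolding closed_subroot_system_def subroot_system_def
    by metis
  show 3: "x \<in> \<Delta> \<Longrightarrow> y \<in> \<Delta> \<Longrightarrow> x + y \<in> \<Phi> \<Longrightarrow> x + y \<in> \<Delta>" for x y
    using assms unfolding closed_subroot_system_def by auto
  show "x \<in> \<Delta> \<Longrightarrow> y \<in> \<Delta> \<Longrightarrow> x - y \<in> \<Phi> \<Longrightarrow> x - y \<in> \<Delta>"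
    using 2[of y] 3[of x "- y"] by simp
qed

definition offset :: "(nat \<Rightarrow> real) \<Rightarrow> 'v \<Rightarrow> real"
  where "offset p x = (\<Sum>i\<in>{1..n}. p i * form x (eps i))"

lemma linear_offset: "linear (offset p)"
  by (rule linearI) (auto simp: offset_def algebra_simps sum.distrib sum_distrib_left)

lemma offset_simps [simp]:
  "offset p (x + y) = offset p x + offset p y"
  "offset p (x - y) = offset p x - offset p y"
  "offset p (c *\<^sub>R x) = c * offset p x"
  "offset p (- x) = - offset p x"
  "offset p delta = 0"
  using linear_offset[of p] by (auto simp: linear_add linear_diff linear_scale linear_neg)
     (simp add: offset_def)

lemma offset_eps [simp]:
  assumes "i \<in> {1..n}" shows "offset p (eps i) = p i"
proof -
  have "offset p (eps i) = (\<Sum>j\<in>{1..n}. if i = j then p j else 0)"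
    unfolding offset_def using assms by (intro sum.cong) (auto simp: eps_orthonormal)
  also have "\<dots> = p i" using assms by simp
  finally show ?thesis .
qed

text \<open>For a short root this is the distance from the base point \<open>p i\<close> of its direction.\<close>

definition shifted :: "(nat \<Rightarrow> real) \<Rightarrow> 'v \<Rightarrow> real"
  where "shifted p x = delta_coord x - offset p x"

lemma linear_shifted: "linear (shifted p)"
  by (rule linearI) (auto simp: shifted_def algebra_simps)

lemma offset_unit_half:
  assumes p: "\<And>i. i \<in> {1..n} \<Longrightarrow> p i - 1/2 \<in> \<int>" and u: "u \<in> units"
  shows "offset p u - 1/2 \<in> \<int>"
  using u
proof (cases rule: unit_cases)
  case (1 i)
  then show ?thesis using p by simp
next
  case (2 i)
  have "- (p i - 1/2) - 1 \<in> \<int>" using p[OF 2(1)] by (intro Ints_diff Ints_1) (simp only: minus_in_Ints_iff)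
  then show ?thesis using 2 by (simp add: algebra_simps)
qed

text \<open>Short roots and the \<open>p i\<close> have half-integral \<open>\<delta>\<close>-coordinates, so the halves cancel for all three kinds.\<close>

lemma shifted_root_integral:
  assumes p: "\<And>i. i \<in> {1..n} \<Longrightarrow> p i - 1/2 \<in> \<int>" and x: "x \<in> \<Phi>"
  shows "shifted p x \<in> \<int>"
  using x
proof (cases rule: root_cases)
  case (short u a)
  show ?thesis
    using half_integer_diff[OF short(2) offset_unit_half[of p, OF p short(1)]] short
    by (simp add: shifted_def)
next
  case (long u b)
  have "2 * b - 2 * offset p u \<in> \<int>"
    using long half_integer_double[OF offset_unit_half[of p, OF p long(1)]]
    by (intro Ints_diff) simp_all
  then show ?thesis using long by (simp add: shifted_def)
next
  case (intermediate u v c)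
  note half = offset_unit_half[of p, OF p intermediate(1)] offset_unit_half[of p, OF p intermediate(2)]
  have "c - (offset p u + offset p v) \<in> \<int>"
    using intermediate(4) half_integer_add[OF half] by (rule Ints_diff)
  then show ?thesis using intermediate by (simp add: shifted_def)
qed

lemma congruent_roots_shifted_one:
  assumes p: "\<And>i. i \<in> {1..n} \<Longrightarrow> p i - 1/2 \<in> \<int>"
  shows "congruent_roots (shifted p) 1 = \<Phi>"
  using shifted_root_integral[of p, OF p] unfolding congruent_roots_def
  by (auto elim!: Ints_cases)

lemma shifted_eps [simp]: "i \<in> {1..n} \<Longrightarrow> shifted p (eps i + a *\<^sub>R delta) = a - p i"
  by (simp add: shifted_def)

text \<open>The set contains \<open>eps 1 + p 1 \<delta>\<close>, and it misses the next short root in this direction, where the functional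
  takes the value 1.\<close>

lemma congruent_roots_shifted_closed_proper:
  assumes p: "\<And>i. i \<in> {1..n} \<Longrightarrow> p i - 1/2 \<in> \<int>" and "n \<ge> 1" "m \<noteq> 1"
  shows "closed_subroot_system form \<Phi> (congruent_roots (shifted p) m)"
    and "congruent_roots (shifted p) m \<noteq> \<Phi>"
proof -
  have 1: "1 \<in> {1..n}" using assms by simp
  have "eps 1 + p 1 *\<^sub>R delta \<in> \<Phi>" using short_root_iff[OF eps_unit[OF 1]] p[OF 1] by blast
  moreover have "shifted p (eps 1 + p 1 *\<^sub>R delta) = of_nat m * of_int 0" using 1 by simp
  ultimately have "eps 1 + p 1 *\<^sub>R delta \<in> congruent_roots (shifted p) m"
    unfolding congruent_roots_def by blast
  then show "closed_subroot_system form \<Phi> (congruent_roots (shifted p) m)"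
    by (intro closed_congruent_roots linear_shifted) auto
  have "(p 1 + 1) - 1/2 \<in> \<int>" using Ints_add[OF p[OF 1] Ints_1] by (simp add: algebra_simps)
  then have root: "eps 1 + (p 1 + 1) *\<^sub>R delta \<in> \<Phi>" using short_root_iff[OF eps_unit[OF 1]] by blast
  have "shifted p (eps 1 + (p 1 + 1) *\<^sub>R delta) \<noteq> of_nat m * of_int k" for k :: int
  proof
    assume "shifted p (eps 1 + (p 1 + 1) *\<^sub>R delta) = of_nat m * of_int k"
    then have "1 = real_of_int (int m * k)" using 1 by simp
    then have "int m * k = 1" by linarith
    then show False using \<open>m \<noteq> 1\<close> by (auto simp: zmult_eq_1_iff)
  qed
  then have "eps 1 + (p 1 + 1) *\<^sub>R delta \<notin> congruent_roots (shifted p) m"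
    unfolding congruent_roots_def by blast
  with root show "congruent_roots (shifted p) m \<noteq> \<Phi>" by blast
qed

section \<open>Closed subroot systems with a short root in every direction\<close>

text \<open>The trivial subgroup is included: there \<open>m = 0\<close>.\<close>

lemma int_subgroup_multiples:
  fixes G :: "int set"
  assumes "0 \<in> G" "\<And>k l. k \<in> G \<Longrightarrow> l \<in> G \<Longrightarrow> k - l \<in> G"
  shows "\<exists>m::nat. G = range ((*) (int m))"
proof -
  have "k \<in> G" if "k \<in> group_closure G" for k
    using that by induction (use assms in auto)
  then have "G = group_closure G" by (auto intro: group_closure.base)
  then have "G = range ((*) (Gcd G))" by (metis group_closure_eq)
  moreover have "Gcd G = int (nat (Gcd G))" by simp
  ultimately show ?thesis by metis
qed

text \<open>Write \<open>S u g\<close> if the short root in direction \<open>u\<close> at distance \<open>g\<close> from the base point lies in \<open>\<Delta>\<close>. For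
  orthogonal \<open>u, v\<close> the sum of short roots at distances \<open>g\<close> and \<open>h\<close> is an intermediate root; removing the
  base point of \<open>u\<close> leaves the direction \<open>v\<close> at distance \<open>g + h\<close>. With \<open>h = 0\<close> this shows that the distances are
  the same in all directions, and in general that they are closed under addition. The base points in
  turn decide membership of the other roots: a long or intermediate root is in \<open>\<Delta>\<close> exactly if removing a
  base point leaves a short root of \<open>\<Delta>\<close>.\<close>

lemma closed_with_all_short_directions:
  assumes n: "n \<ge> 2" and \<Delta>: "closed_subroot_system form \<Phi> \<Delta>"
    and p: "\<And>i. i \<in> {1..n} \<Longrightarrow> eps i + p i *\<^sub>R delta \<in> \<Delta>"
  shows "\<exists>m. \<Delta> = congruent_roots (shifted p) m"
proof -
  define q where "q = offset p"
  note q = offset_simps[of p, folded q_def]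
  have base: "u + q u *\<^sub>R delta \<in> \<Delta>" if "u \<in> units" for u
    using that
  proof (cases rule: unit_cases)
    case (1 i)
    then show ?thesis using p by (simp add: q_def)
  next
    case (2 i)
    then show ?thesis using closedD(2)[OF \<Delta> p[of i]] by (simp add: q_def)
  qed
  have half: "a - 1/2 \<in> \<int>" if "u \<in> units" "u + a *\<^sub>R delta \<in> \<Delta>" for u a
    using that short_root_iff closedD(1)[OF \<Delta>] by blast
  have qhalf: "q u - 1/2 \<in> \<int>" if "u \<in> units" for u
    using half[OF that base[OF that]] .
  define S where "S u g \<longleftrightarrow> u + (q u + g) *\<^sub>R delta \<in> \<Delta>" for u and g :: real
  have S_int: "g \<in> \<int>" if "u \<in> units" "S u g" for u g
    using half_integer_diff[OF half[OF that(1) that(2)[unfolded S_def]] qhalf[OF that(1)]] by simp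
  have S_half: "q u + g - 1/2 \<in> \<int>" if "u \<in> units" "g \<in> \<int>" for u g
    using Ints_add[OF qhalf[OF that(1)] that(2)] by (simp add: algebra_simps)
  have S_plus: "S v (g + h)" if u: "u \<in> units" and v: "v \<in> units" and o: "form u v = 0"
    and g: "S u g" and h: "S v h" for u v g h
  proof -
    have gh: "g \<in> \<int>" "h \<in> \<int>" using S_int u v g h by auto
    have "u + v + ((q u + g) + (q v + h)) *\<^sub>R delta \<in> \<Phi>"
      using u v o by (rule intermediate_rootI) (rule half_integer_add S_half u v gh)+
    then have "(u + (q u + g) *\<^sub>R delta) + (v + (q v + h) *\<^sub>R delta) \<in> \<Phi>"
      by (simp add: algebra_simps)
    note sum = closedD(3)[OF \<Delta> g[unfolded S_def] h[unfolded S_def] this]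
    have "v + (q v + (g + h)) *\<^sub>R delta \<in> \<Phi>"
      using v short_root_iff S_half Ints_add[OF gh] by blast
    also have "v + (q v + (g + h)) *\<^sub>R delta =
        (u + (q u + g) *\<^sub>R delta) + (v + (q v + h) *\<^sub>R delta) - (u + q u *\<^sub>R delta)"
      by (simp add: algebra_simps)
    finally have "\<dots> \<in> \<Delta>" by (rule closedD(4)[OF \<Delta> sum base[OF u]])
    then show ?thesis unfolding S_def by (simp add: algebra_simps)
  qed
  have S_0: "S u 0" if "u \<in> units" for u using base[OF that] by (simp add: S_def)
  have S_orth: "S v g" if "u \<in> units" "v \<in> units" "form u v = 0" "S u g" for u v g
    using S_plus[OF that(1-4) S_0[OF that(2)]] by simp
  have S_all: "S v g" if u: "u \<in> units" and v: "v \<in> units" and g: "S u g" for u v g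
    using u v
  proof (cases rule: two_units_cases)
    case 1
    then show ?thesis using g by simp
  next
    case 2
    \<comment> \<open>Opposite units are not orthogonal, so the shift takes a detour through a third unit.\<close>
    obtain w where w: "w \<in> units" "form u w = 0" using orthogonal_unit_exists[OF n u] .
    have "form w v = 0" using 2 w form_sym by simp
    then show ?thesis using S_orth[OF u w g] S_orth[OF w(1) v] by blast
  next
    case 3
    then show ?thesis using S_orth u v g by blast
  qed
  have 1: "eps 1 \<in> units" using n by (intro eps_unit) auto
  define G where "G = {k::int. S (eps 1) (of_int k)}"
  have S_iff: "S u g \<longleftrightarrow> (\<exists>k\<in>G. g = of_int k)" if "u \<in> units" for u g
    using S_all[OF that 1, of g] S_all[OF 1 that, of g] S_int[OF that, of g]
    by (auto simp: G_def elim!: Ints_cases)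
  have "k - l \<in> G" if k: "k \<in> G" and l: "l \<in> G" for k l
  proof -
    obtain v where v: "v \<in> units" "form (eps 1) v = 0" using orthogonal_unit_exists[OF n 1] .
    have "S (eps 1) (of_int l)" using l by (simp add: G_def)
    then have "- (eps 1 + (q (eps 1) + of_int l) *\<^sub>R delta) \<in> \<Delta>"
      unfolding S_def by (rule closedD(2)[OF \<Delta>])
    then have "S (- eps 1) (- of_int l)" unfolding S_def by (simp add: q algebra_simps)
    then have "S v (- of_int l)" using S_all uminus_unit[OF 1] v by blast
    from S_plus[OF 1 v _ this, of "of_int k"] k have "S v (of_int k + - of_int l)"
      by (simp add: G_def)
    then have "S (eps 1) (of_int (k - l))" using S_all[OF v(1) 1] by simp
    then show ?thesis by (simp add: G_def)
  qed
  moreover have "0 \<in> G" using S_0[OF 1] by (simp add: G_def)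
  ultimately obtain m :: nat where m: "G = range ((*) (int m))" using int_subgroup_multiples by blast
  have S_m: "S u g \<longleftrightarrow> (\<exists>k::int. g = of_nat m * of_int k)" if "u \<in> units" for u g
    unfolding S_iff[OF that] m by auto
  have "x \<in> \<Delta> \<longleftrightarrow> (\<exists>k::int. shifted p x = of_nat m * of_int k)" if "x \<in> \<Phi>" for x
    using that
  proof (cases rule: root_cases)
    case (short u a)
    then have "x \<in> \<Delta> \<longleftrightarrow> S u (a - q u)" "shifted p x = a - q u"
      by (simp_all add: S_def shifted_def q_def)
    then show ?thesis using S_m short by simp
  next
    case (long u b)
    define g where "g = 2 * b - 2 * q u"
    have sx: "shifted p x = g" using long by (simp add: shifted_def q_def g_def)
    have g: "g \<in> \<int>" unfolding g_def
      using long half_integer_double[OF qhalf[OF long(1)]] by (intro Ints_diff) simp_all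
    have x: "x = (u + (q u + g) *\<^sub>R delta) + (u + q u *\<^sub>R delta)"
      unfolding g_def long(3) by (simp add: algebra_simps scaleR_2)
    have "x \<in> \<Delta> \<longleftrightarrow> S u g"
    proof
      assume "x \<in> \<Delta>"
      have "x - (u + q u *\<^sub>R delta) \<in> \<Delta>"
        using \<open>x \<in> \<Delta>\<close> base[OF long(1)]
      proof (rule closedD(4)[OF \<Delta>])
        show "x - (u + q u *\<^sub>R delta) \<in> \<Phi>"
          unfolding x using short_root_iff[OF long(1)] S_half[OF long(1) g] by simp
      qed
      then show "S u g" unfolding S_def x by simp
    next
      assume "S u g"
      then show "x \<in> \<Delta>"
        using base[OF long(1)] that closedD(3)[OF \<Delta>] unfolding x S_def by blast
    qed
    then show ?thesis using S_m long sx by simp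
  next
    case (intermediate u v c)
    define g where "g = c - (q u + q v)"
    have sx: "shifted p x = g" using intermediate by (simp add: shifted_def q_def g_def)
    have g: "g \<in> \<int>" unfolding g_def
      using intermediate half_integer_add[OF qhalf qhalf] by (intro Ints_diff) simp_all
    have x: "x = (u + (q u + g) *\<^sub>R delta) + (v + q v *\<^sub>R delta)"
      unfolding g_def intermediate(5) by (simp add: algebra_simps)
    have "x \<in> \<Delta> \<longleftrightarrow> S u g"
    proof
      assume "x \<in> \<Delta>"
      have "x - (v + q v *\<^sub>R delta) \<in> \<Delta>"
        using \<open>x \<in> \<Delta>\<close> base[OF intermediate(2)]
      proof (rule closedD(4)[OF \<Delta>])
        show "x - (v + q v *\<^sub>R delta) \<in> \<Phi>"
          unfolding x using short_root_iff[OF intermediate(1)] S_half[OF intermediate(1) g] by simp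
      qed
      then show "S u g" unfolding S_def x by simp
    next
      assume "S u g"
      then show "x \<in> \<Delta>"
        using base[OF intermediate(2)] that closedD(3)[OF \<Delta>] unfolding x S_def by blast
    qed
    then show ?thesis using S_m intermediate sx by simp
  qed
  then have "\<Delta> = congruent_roots (shifted p) m"
    unfolding congruent_roots_def using closedD(1)[OF \<Delta>] by blast
  then show ?thesis ..
qed

text \<open>The period of \<open>\<Delta>\<close> divides \<open>q\<close>, by the second root given in direction 1, and it is not 1.\<close>

lemma closed_between_prime_and_all:
  assumes n: "n \<ge> 2" and \<Delta>: "closed_subroot_system form \<Phi> \<Delta>" "\<Delta> \<noteq> \<Phi>"
    and p: "\<And>i. i \<in> {1..n} \<Longrightarrow> eps i + p i *\<^sub>R delta \<in> \<Delta>"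
    and q: "prime q" "eps 1 + (p 1 + of_nat q) *\<^sub>R delta \<in> \<Delta>"
  shows "\<Delta> = congruent_roots (shifted p) q"
proof -
  obtain m where m: "\<Delta> = congruent_roots (shifted p) m"
    using closed_with_all_short_directions[OF n \<Delta>(1)] p by blast
  have half: "p i - 1/2 \<in> \<int>" if "i \<in> {1..n}" for i
    using p[OF that] short_root_iff[OF eps_unit[OF that]] closedD(1)[OF \<Delta>(1)] by blast
  have 1: "1 \<in> {1..n}" using n by simp
  obtain k :: int where "shifted p (eps 1 + (p 1 + of_nat q) *\<^sub>R delta) = of_nat m * of_int k"
    using q(2) unfolding m congruent_roots_def by blast
  then have "of_nat q = real_of_int (int m * k)" using 1 by simp
  then have "int q = int m * k" by linarith
  then have "m dvd q" by (metis dvd_triv_left int_dvd_int_iff)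
  moreover have "m \<noteq> 1" using congruent_roots_shifted_one[of p, OF half] m \<Delta>(2) by metis
  ultimately have "m = q" using q(1) by (auto simp: prime_nat_iff)
  then show ?thesis using m by simp
qed

lemma maximal_congruent_roots_prime:
  assumes n: "n \<ge> 2" and p: "\<And>i. i \<in> {1..n} \<Longrightarrow> p i - 1/2 \<in> \<int>" and q: "prime q"
  shows "maximal_closed_subroot_system form \<Phi> (congruent_roots (shifted p) q)"
proof -
  let ?K = "congruent_roots (shifted p) q"
  have mem: "eps i + (p i + of_nat q * of_int k) *\<^sub>R delta \<in> ?K" if i: "i \<in> {1..n}" for i and k :: int
  proof -
    have "(p i + of_nat q * of_int k) - 1/2 \<in> \<int>"
      using Ints_add[OF p[OF i], of "of_nat q * of_int k"] by (simp add: algebra_simps)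
    then show ?thesis
      using i short_root_iff[OF eps_unit[OF i]] by (auto simp: congruent_roots_def)
  qed
  have "\<Delta> = ?K" if \<Delta>: "closed_subroot_system form \<Phi> \<Delta>" "?K \<subseteq> \<Delta>" "\<Delta> \<subset> \<Phi>" for \<Delta>
  proof (rule closed_between_prime_and_all[OF n \<Delta>(1) _ _ q])
    show "\<Delta> \<noteq> \<Phi>" using \<Delta> by blast
    show "eps i + p i *\<^sub>R delta \<in> \<Delta>" if "i \<in> {1..n}" for i
      using mem[OF that, of 0] \<Delta> by auto
    show "eps 1 + (p 1 + of_nat q) *\<^sub>R delta \<in> \<Delta>"
      using mem[of 1 1] n \<Delta> by auto
  qed
  moreover have "closed_subroot_system form \<Phi> ?K" "?K \<noteq> \<Phi>"
    using congruent_roots_shifted_closed_proper[of p q, OF p] n q by (auto simp: prime_nat_iff)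
  ultimately show ?thesis unfolding maximal_closed_subroot_system_def by blast
qed

lemma maximal_eqI:
  assumes "maximal_closed_subroot_system form \<Phi> \<Psi>" "closed_subroot_system form \<Phi> \<Delta>"
    "\<Psi> \<subseteq> \<Delta>" "\<Delta> \<noteq> \<Phi>"
  shows "\<Psi> = \<Delta>"
  using assms closedD(1)[OF assms(2)] unfolding maximal_closed_subroot_system_def by blast

section \<open>Lifts of finite subroot systems\<close>

abbreviation outer_sum :: "nat set \<Rightarrow> 'v \<Rightarrow> real"
  where "outer_sum J \<equiv> offset (\<lambda>i. if i \<in> J then 0 else 1)"

lemma even_real_cases: "x \<in> {0, 2, - 2} \<Longrightarrow> \<exists>k::int. x = of_nat 2 * of_int k" for x :: real
  by (auto intro: exI[of _ 0] exI[of _ 1] exI[of _ "- 1"])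

lemma odd_real: "\<bar>x\<bar> = 1 \<Longrightarrow> x \<noteq> of_nat 2 * of_int k" for x :: real and k :: int
proof
  assume "\<bar>x\<bar> = 1" "x = of_nat 2 * of_int k"
  then have "\<bar>2 * k\<bar> = 1" by linarith
  then show False by presburger
qed

text \<open>The sum of the coordinates outside \<open>J\<close> is odd exactly for the short roots outside \<open>J\<close> and for the
  intermediate roots with one index inside and one outside, which are the roots that \<open>A\<^sub>J\<close> omits.\<close>

lemma lift_eq_congruent_roots:
  assumes J: "J \<subseteq> {1..n}"
  shows "lift n eps delta (A_J n eps J) = congruent_roots (outer_sum J) 2"
proof (intro equalityI subsetI)
  fix x assume "x \<in> lift n eps delta (A_J n eps J)"
  then obtain \<alpha> r where x: "x \<in> \<Phi>" "x = \<alpha> + r *\<^sub>R delta" and \<alpha>: "\<alpha> \<in> A_J n eps J"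
    unfolding lift_def by blast
  have inside: "outer_sum J (eps i) = 0" if "i \<in> J" for i
    using that J by (subst offset_eps) auto
  have "outer_sum J \<alpha> \<in> {0, 2, - 2}"
    using \<alpha> unfolding A_J_def by (elim UnE CollectE exE conjE) (auto simp: inside)
  then have "outer_sum J x \<in> {0, 2, - 2}" using x by simp
  then show "x \<in> congruent_roots (outer_sum J) 2"
    using even_real_cases x(1) unfolding congruent_roots_def by blast
next
  fix x assume "x \<in> congruent_roots (outer_sum J) 2"
  then obtain k :: int where x: "x \<in> \<Phi>" and k: "outer_sum J x = of_nat 2 * of_int k"
    unfolding congruent_roots_def by blast
  have "\<exists>\<alpha>\<in>A_J n eps J. \<exists>r. x = \<alpha> + r *\<^sub>R delta"
    using x
  proof (cases rule: Phi_cases)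
    case (short s i r)
    have "i \<in> J"
    proof (rule ccontr)
      assume "i \<notin> J"
      then have "\<bar>outer_sum J x\<bar> = 1" using short by auto
      then show False using odd_real k by blast
    qed
    then have "s *\<^sub>R eps i \<in> A_J n eps J" unfolding A_J_def using short(1) by blast
    then show ?thesis using short(3) by blast
  next
    case (long s i r)
    have "(2 * s) *\<^sub>R eps i \<in> A_J n eps J"
      unfolding A_J_def using long(1,2) by (cases "i \<in> J") blast+
    then show ?thesis using long(3) by blast
  next
    case (intermediate s t i j r)
    have "i \<in> J \<longleftrightarrow> j \<in> J"
    proof (rule ccontr)
      assume "\<not> (i \<in> J \<longleftrightarrow> j \<in> J)"
      then have "\<bar>outer_sum J x\<bar> = 1" using intermediate by auto
      then show False using odd_real k by blast
    qed
    then have "s *\<^sub>R eps i + t *\<^sub>R eps j \<in> A_J n eps J"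
      unfolding A_J_def using intermediate(1-5) by (cases "i \<in> J") blast+
    then show ?thesis using intermediate(6) by blast
  qed
  then show "x \<in> lift n eps delta (A_J n eps J)" unfolding lift_def using x by blast
qed

lemma lift_closed_proper:
  assumes J: "J \<subset> {1..n}"
  shows "closed_subroot_system form \<Phi> (lift n eps delta (A_J n eps J))"
    and "lift n eps delta (A_J n eps J) \<noteq> \<Phi>"
proof -
  note L = lift_eq_congruent_roots[of J]
  have Jn: "J \<subseteq> {1..n}" using J by blast
  obtain i where i: "i \<in> {1..n}" "i \<notin> J" using J by blast
  have "2 *\<^sub>R eps i + (2 * 0) *\<^sub>R delta \<in> \<Phi>" using i by (intro long_rootI eps_unit) auto
  moreover have "outer_sum J (2 *\<^sub>R eps i + (2 * 0) *\<^sub>R delta) = of_nat 2 * of_int 1"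
    using i by simp
  ultimately have "2 *\<^sub>R eps i + (2 * 0) *\<^sub>R delta \<in> congruent_roots (outer_sum J) 2"
    unfolding congruent_roots_def by blast
  then show "closed_subroot_system form \<Phi> (lift n eps delta (A_J n eps J))"
    unfolding L[OF Jn] by (intro closed_congruent_roots linear_offset) auto
  have root: "eps i + (1/2) *\<^sub>R delta \<in> \<Phi>" using i short_root_iff[OF eps_unit] by simp
  have "\<bar>outer_sum J (eps i + (1/2) *\<^sub>R delta)\<bar> = 1" using i by simp
  then have "eps i + (1/2) *\<^sub>R delta \<notin> congruent_roots (outer_sum J) 2"
    unfolding congruent_roots_def using odd_real by blast
  then show "lift n eps delta (A_J n eps J) \<noteq> \<Phi>" unfolding L[OF Jn] using root by blast
qed

definition short_directions :: "'v set \<Rightarrow> nat set"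
  where "short_directions \<Delta> = {i \<in> {1..n}. \<exists>a. eps i + a *\<^sub>R delta \<in> \<Delta>}"

text \<open>If an intermediate root of \<open>\<Delta>\<close> involves a direction with a short root, subtracting this short root leaves
  a short root in the other direction. So either both directions have short roots or neither does.\<close>

lemma closed_subset_lift:
  assumes \<Delta>: "closed_subroot_system form \<Phi> \<Delta>"
  shows "\<Delta> \<subseteq> lift n eps delta (A_J n eps (short_directions \<Delta>))"
proof
  fix x assume x: "x \<in> \<Delta>"
  define D where "D = short_directions \<Delta>"
  have Dn: "D \<subseteq> {1..n}" by (auto simp: D_def short_directions_def)
  have in_D: "i \<in> D" if "s \<in> signs" "i \<in> {1..n}" "s *\<^sub>R eps i + a *\<^sub>R delta \<in> \<Delta>" for s i a
  proof (cases "s = 1")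
    case True
    then show ?thesis using that by (auto simp: D_def short_directions_def)
  next
    case False
    then have "eps i + (- a) *\<^sub>R delta \<in> \<Delta>" using that closedD(2)[OF \<Delta> that(3)] by simp
    then show ?thesis using that unfolding D_def short_directions_def by blast
  qed
  have out_D: "\<exists>a. t *\<^sub>R eps i + a *\<^sub>R delta \<in> \<Delta>" if t: "t \<in> signs" and i: "i \<in> D" for t i
  proof -
    obtain a where a: "eps i + a *\<^sub>R delta \<in> \<Delta>" using i unfolding D_def short_directions_def by blast
    have "t *\<^sub>R eps i + (t * a) *\<^sub>R delta \<in> \<Delta>" using a closedD(2)[OF \<Delta> a] t by auto
    then show ?thesis by blast
  qed
  have sub: "i \<in> D" if st: "s \<in> signs" "t \<in> signs" "i \<in> {1..n}" and j: "j \<in> D"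
    and m: "s *\<^sub>R eps i + t *\<^sub>R eps j + of_int r *\<^sub>R delta \<in> \<Delta>" for s t i j and r :: int
  proof -
    obtain a where a: "t *\<^sub>R eps j + a *\<^sub>R delta \<in> \<Delta>" using out_D st j by blast
    have units: "t *\<^sub>R eps j \<in> units" "s *\<^sub>R eps i \<in> units"
      unfolding Gr_short_def using st j Dn by blast+
    have "a - 1/2 \<in> \<int>" using a short_root_iff[OF units(1)] closedD(1)[OF \<Delta>] by blast
    then have "of_int (r - 1) - (a - 1/2) \<in> \<int>" by (rule Ints_diff[OF Ints_of_int])
    then have "(of_int r - a) - 1/2 \<in> \<int>" by (simp add: algebra_simps)
    then have "s *\<^sub>R eps i + (of_int r - a) *\<^sub>R delta \<in> \<Phi>" using short_root_iff[OF units(2)] by blast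
    also have "s *\<^sub>R eps i + (of_int r - a) *\<^sub>R delta =
        (s *\<^sub>R eps i + t *\<^sub>R eps j + of_int r *\<^sub>R delta) - (t *\<^sub>R eps j + a *\<^sub>R delta)"
      by (simp add: algebra_simps)
    finally have "s *\<^sub>R eps i + (of_int r - a) *\<^sub>R delta \<in> \<Delta>"
      using closedD(4)[OF \<Delta> m a] by (simp add: algebra_simps)
    then show ?thesis using in_D st by blast
  qed
  have "outer_sum D x \<in> {0, 2, - 2}"
    using closedD(1)[OF \<Delta> x]
  proof (cases rule: Phi_cases)
    case (short s i r)
    then have "i \<in> D" using in_D x by blast
    then show ?thesis using short by simp
  next
    case (long s i r)
    then show ?thesis by auto
  next
    case (intermediate s t i j r)
    have "i \<in> D \<longleftrightarrow> j \<in> D"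
    proof
      show "j \<in> D \<Longrightarrow> i \<in> D" using sub intermediate x by blast
      have "t *\<^sub>R eps j + s *\<^sub>R eps i + of_int r *\<^sub>R delta \<in> \<Delta>"
        using x intermediate(6) by (simp add: add.commute)
      then show "i \<in> D \<Longrightarrow> j \<in> D" using sub intermediate by blast
    qed
    then show ?thesis using intermediate by auto
  qed
  then show "x \<in> lift n eps delta (A_J n eps D)"
    unfolding lift_eq_congruent_roots[OF Dn] congruent_roots_def
    using even_real_cases closedD(1)[OF \<Delta> x] by blast
qed

text \<open>Let \<open>D\<close> be the set of short directions of a closed \<open>\<Delta> \<noteq> \<Phi>\<close> above the lift of \<open>A\<^sub>J\<close>. If \<open>D\<close> were everything, \<open>\<Delta>\<close> would have a
  period \<open>m\<close> that divides the distances \<open>2b - 2p\<^sub>i\<close> of all long roots \<open>2\<epsilon>\<^sub>i + 2b\<delta>\<close> with a fixed \<open>i \<notin> J\<close>. These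
  are all the odd numbers, so \<open>m = 1\<close>. Hence \<open>\<Delta>\<close> lies in the lift of \<open>A\<^sub>D\<close> with \<open>J \<subseteq> D\<close>. An index in \<open>D - J\<close> and
  one outside \<open>D\<close> would give an intermediate root in the lift of \<open>A\<^sub>J\<close> but not in that of \<open>A\<^sub>D\<close>.\<close>

lemma maximal_lift:
  assumes n: "n \<ge> 2" and J: "J \<subset> {1..n}"
  shows "maximal_closed_subroot_system form \<Phi> (lift n eps delta (A_J n eps J))"
proof -
  let ?L = "lift n eps delta (A_J n eps J)"
  have Jn: "J \<subseteq> {1..n}" using J by blast
  note L = lift_eq_congruent_roots[OF Jn]
  obtain i where i: "i \<in> {1..n}" "i \<notin> J" using J by blast
  have "\<Delta> = ?L" if \<Delta>: "closed_subroot_system form \<Phi> \<Delta>" "?L \<subseteq> \<Delta>" "\<Delta> \<subset> \<Phi>" for \<Delta>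
  proof -
    define D where "D = short_directions \<Delta>"
    have Dn: "D \<subseteq> {1..n}" by (auto simp: D_def short_directions_def)
    have JD: "J \<subseteq> D"
    proof
      fix j assume j: "j \<in> J"
      then have jn: "j \<in> {1..n}" using Jn by blast
      have "eps j + (1/2) *\<^sub>R delta \<in> \<Phi>" using short_root_iff[OF eps_unit[OF jn]] by simp
      then have "eps j + (1/2) *\<^sub>R delta \<in> ?L"
        unfolding L congruent_roots_def using j jn by auto
      then show "j \<in> D" using \<Delta> jn unfolding D_def short_directions_def by blast
    qed
    have "D \<noteq> {1..n}"
    proof
      assume "D = {1..n}"
      then have "\<forall>i\<in>{1..n}. \<exists>a. eps i + a *\<^sub>R delta \<in> \<Delta>"
        unfolding D_def short_directions_def by blast
      then obtain p where p: "\<And>i. i \<in> {1..n} \<Longrightarrow> eps i + p i *\<^sub>R delta \<in> \<Delta>" by metis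
      then obtain m where m: "\<Delta> = congruent_roots (shifted p) m"
        using closed_with_all_short_directions[OF n \<Delta>(1)] by blast
      have half: "p i - 1/2 \<in> \<int>" if "i \<in> {1..n}" for i
        using p[OF that] short_root_iff[OF eps_unit[OF that]] closedD(1)[OF \<Delta>(1)] by blast
      have long: "\<exists>k::int. 2 * of_int b - 2 * p i = of_nat m * of_int k" for b :: int
      proof -
        have "2 *\<^sub>R eps i + (2 * of_int b) *\<^sub>R delta \<in> \<Phi>" using i by (intro long_rootI eps_unit) auto
        moreover have "outer_sum J (2 *\<^sub>R eps i + (2 * of_int b) *\<^sub>R delta) = of_nat 2 * of_int 1"
          using i by simp
        ultimately have "2 *\<^sub>R eps i + (2 * of_int b) *\<^sub>R delta \<in> ?L"
          unfolding L congruent_roots_def by blast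
        then have "2 *\<^sub>R eps i + (2 * of_int b) *\<^sub>R delta \<in> \<Delta>" using \<Delta>(2) by blast
        then have "\<exists>k::int. shifted p (2 *\<^sub>R eps i + (2 * of_int b) *\<^sub>R delta) = of_nat m * of_int k"
          unfolding m congruent_roots_def by blast
        moreover have "shifted p (2 *\<^sub>R eps i + (2 * of_int b) *\<^sub>R delta) = 2 * of_int b - 2 * p i"
          using i by (simp add: shifted_def eps_unit)
        ultimately show ?thesis by simp
      qed
      obtain h :: int where h: "p i = of_int h + 1/2"
        using half[OF i(1)] by (auto elim!: Ints_cases simp: algebra_simps)
      have dvd: "int m dvd 2 * b - 2 * h - 1" for b :: int
      proof -
        obtain k :: int where "2 * of_int b - 2 * p i = of_nat m * of_int k" using long by blast
        then have "real_of_int (2 * b - 2 * h - 1) = of_int (int m * k)" using h by simp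
        then show ?thesis by (simp only: of_int_eq_iff) simp
      qed
      have "int m dvd 1" using dvd[of "h + 1"] by simp
      then have "m = 1" by simp
      then have "\<Delta> = \<Phi>" using m congruent_roots_shifted_one[of p, OF half] by simp
      then show False using \<Delta>(3) by blast
    qed
    then obtain l where l: "l \<in> {1..n}" "l \<notin> D" using Dn by blast
    have "D \<subseteq> J"
    proof (rule ccontr)
      assume "\<not> D \<subseteq> J"
      then obtain k where k: "k \<in> D" "k \<notin> J" by blast
      have kn: "k \<in> {1..n}" using k Dn by blast
      have "k \<noteq> l" using k l by blast
      let ?x = "eps k + eps l + 0 *\<^sub>R delta"
      have x: "?x \<in> \<Phi>" using kn l \<open>k \<noteq> l\<close> by (intro intermediate_rootI eps_unit) (simp_all add: eps_orthonormal)
      have "l \<notin> J" using l JD by blast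
      then have "outer_sum J ?x = of_nat 2 * of_int 1" using kn l k by simp
      then have "?x \<in> ?L" unfolding L congruent_roots_def using x by blast
      then have "?x \<in> lift n eps delta (A_J n eps D)"
        using closed_subset_lift[OF \<Delta>(1)] \<Delta>(2) unfolding D_def by blast
      moreover have "\<bar>outer_sum D ?x\<bar> = 1" using kn l k by simp
      ultimately show False
        unfolding lift_eq_congruent_roots[OF Dn] congruent_roots_def using odd_real by blast
    qed
    then have "D = J" using JD by blast
    then show ?thesis using closed_subset_lift[OF \<Delta>(1)] \<Delta>(2) unfolding D_def by simp
  qed
  then show ?thesis
    using lift_closed_proper[OF J] unfolding maximal_closed_subroot_system_def by blast
qed

section \<open>The systems of period two\<close>

abbreviation half_residue :: "nat set \<Rightarrow> nat \<Rightarrow> real"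
  where "half_residue I \<equiv> (\<lambda>i. if i \<in> I then 1/2 else 3/2)"

lemma half_residue_half: "half_residue I i - 1/2 \<in> \<int>"
  by simp

lemma uminus_congruent_roots:
  assumes "linear f" "x \<in> congruent_roots f m"
  shows "- x \<in> congruent_roots f m"
  using closedD(2)[OF closed_congruent_roots[OF assms(1)]] assms(2) by blast

text \<open>Modulo 2 the base points are \<open>1/2\<close> inside \<open>I\<close> and \<open>3/2\<close> outside. The parities in the definition of
  \<open>Psi_I\<close> are those of sums and differences of two base points: the sum is odd and the difference even
  within one class, and conversely across the two classes. A long root would need an even \<open>2p\<^sub>i\<close>, so there is none.\<close>

lemma Psi_I_eq_congruent_roots:
  assumes I: "I \<subseteq> {1..n}"
  shows "Psi_I n eps delta I = congruent_roots (shifted (half_residue I)) 2"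
    (is "_ = ?K")
proof -
  let ?p = "half_residue I"
  define P where "P = Psi_plus eps delta I (1/2) \<union> Psi_plus01 n eps delta I \<union>
             Psi_plus eps delta ({1..n} - I) (3/2)"
  have Psi: "Psi_I n eps delta I = P \<union> uminus ` P" unfolding Psi_I_def P_def Let_def ..
  have P_short: "eps i + (2 * of_int r + ?p i) *\<^sub>R delta \<in> P" if "i \<in> {1..n}" for i and r :: int
    using that unfolding P_def Psi_plus_def by (cases "i \<in> I") auto
  have P_plus_same: "eps i + eps j + (2 * of_int r + 1) *\<^sub>R delta \<in> P"
    and P_minus_same: "eps i - eps j + (2 * of_int r) *\<^sub>R delta \<in> P"
    if "i \<in> {1..n}" "j \<in> {1..n}" "i \<noteq> j" "i \<in> I \<longleftrightarrow> j \<in> I" for i j and r :: int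
    using that unfolding P_def Psi_plus_def by (cases "i \<in> I"; blast)+
  have P_plus_mixed: "eps i + eps j + (2 * of_int r) *\<^sub>R delta \<in> P"
    and P_minus_mixed: "eps i - eps j + (2 * of_int r + 1) *\<^sub>R delta \<in> P"
    if "i \<in> I" "j \<in> {1..n} - I" for i j and r :: int
    using that unfolding P_def Psi_plus01_def by blast+
  have unit_p: "offset ?p u - 1/2 \<in> \<int>" if "u \<in> units" for u
    using offset_unit_half[of ?p, OF half_residue_half that] .
  have K_short: "eps i + (2 * of_int k + ?p i) *\<^sub>R delta \<in> ?K"
    if i: "i \<in> {1..n}" for i and k :: int
  proof -
    have "(of_int (2 * k) + (?p i - 1/2)) \<in> \<int>" by (intro Ints_add Ints_of_int half_residue_half)
    then have "(2 * of_int k + ?p i) - 1/2 \<in> \<int>" by (simp add: algebra_simps)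
    then have "eps i + (2 * of_int k + ?p i) *\<^sub>R delta \<in> \<Phi>" using short_root_iff[OF eps_unit[OF i]] by blast
    moreover have "shifted ?p (eps i + (2 * of_int k + ?p i) *\<^sub>R delta) = of_nat 2 * of_int k" using i by simp
    ultimately show ?thesis unfolding congruent_roots_def by blast
  qed
  have K_intermediate: "u + v + a *\<^sub>R delta \<in> ?K"
    if u: "u \<in> units" "v \<in> units" "form u v = 0"
      and a: "a = offset ?p u + offset ?p v + 2 * of_int k" for u v a and k :: int
  proof -
    have "a \<in> \<int>" unfolding a
      by (intro Ints_add[OF half_integer_add] unit_p u Ints_mult Ints_of_int Ints_numeral)
    moreover have "shifted ?p (u + v + a *\<^sub>R delta) = of_nat 2 * of_int k"
      unfolding shifted_def a using u by simp
    ultimately show ?thesis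
      using intermediate_rootI[OF u] unfolding congruent_roots_def by blast
  qed
  have K_plus: "eps i + eps j + a *\<^sub>R delta \<in> ?K"
    if "i \<in> {1..n}" "j \<in> {1..n}" "i \<noteq> j" "a = ?p i + ?p j + 2 * of_int k" for i j a and k :: int
    using that by (intro K_intermediate[where k = k] eps_unit) (simp_all add: eps_orthonormal)
  have K_minus: "eps i - eps j + a *\<^sub>R delta \<in> ?K"
    if "i \<in> {1..n}" "j \<in> {1..n}" "i \<noteq> j" "a = ?p i - ?p j + 2 * of_int k" for i j a and k :: int
    using K_intermediate[of "eps i" "- eps j" a k] that
    by (simp add: eps_unit uminus_unit eps_orthonormal)
  have same: "Psi_plus eps delta M c \<subseteq> ?K"
    if M: "M \<subseteq> {1..n}" and pc: "\<And>i. i \<in> M \<Longrightarrow> ?p i = c" and c: "2 * c = 1 + 2 * of_int e"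
    for M c and e :: int
  proof
    fix x assume "x \<in> Psi_plus eps delta M c"
    then show "x \<in> ?K" unfolding Psi_plus_def
    proof (elim UnE CollectE exE conjE)
      fix i and r :: int
      assume "x = eps i + (2 * of_int r + c) *\<^sub>R delta" "i \<in> M"
      then show "x \<in> ?K" using K_short[of i r] M pc[of i] by auto
    next
      fix i j and r :: int
      assume x: "x = eps i + eps j + (2 * of_int r + 1) *\<^sub>R delta" and ij: "i \<in> M" "j \<in> M" "i \<noteq> j"
      have eq: "2 * of_int r + 1 = ?p i + ?p j + 2 * of_int (r - e)"
        unfolding pc[OF ij(1)] pc[OF ij(2)] using c by simp
      then show "x \<in> ?K" unfolding x using K_plus[OF _ _ ij(3) eq] ij M by blast
    next
      fix i j and r :: int
      assume x: "x = eps i - eps j + (2 * of_int r) *\<^sub>R delta" and ij: "i \<in> M" "j \<in> M" "i \<noteq> j"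
      have eq: "2 * of_int r = ?p i - ?p j + 2 * of_int r"
        unfolding pc[OF ij(1)] pc[OF ij(2)] by simp
      then show "x \<in> ?K" unfolding x using K_minus[OF _ _ ij(3) eq] ij M by blast
    qed
  qed
  have mixed: "Psi_plus01 n eps delta I \<subseteq> ?K"
  proof
    fix x assume "x \<in> Psi_plus01 n eps delta I"
    then show "x \<in> ?K" unfolding Psi_plus01_def
    proof (elim UnE CollectE exE conjE)
      fix i j and r :: int
      assume x: "x = eps i + eps j + (2 * of_int r) *\<^sub>R delta" and ij: "i \<in> I" "j \<in> {1..n} - I"
      have eq: "2 * of_int r = ?p i + ?p j + 2 * of_int (r - 1)" using ij by simp
      then show "x \<in> ?K" unfolding x using K_plus[OF _ _ _ eq] ij I by blast
    next
      fix i j and r :: int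
      assume x: "x = eps i - eps j + (2 * of_int r + 1) *\<^sub>R delta" and ij: "i \<in> I" "j \<in> {1..n} - I"
      have eq: "2 * of_int r + 1 = ?p i - ?p j + 2 * of_int (r + 1)" using ij by simp
      then show "x \<in> ?K" unfolding x using K_minus[OF _ _ _ eq] ij I by blast
    qed
  qed
  have "P \<subseteq> ?K"
    using same[of I "1/2" 0] same[of "{1..n} - I" "3/2" 1] mixed I unfolding P_def by simp
  then have P_K: "x \<in> ?K" if "x \<in> P" for x using that by blast
  have "x \<in> ?K" if "x \<in> Psi_I n eps delta I" for x
    using that P_K uminus_congruent_roots[OF linear_shifted] unfolding Psi by blast
  moreover have "x \<in> Psi_I n eps delta I" if "x \<in> ?K" for x
  proof -
    have neg: "- y \<in> Psi_I n eps delta I" if "y \<in> Psi_I n eps delta I" for y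
      using that unfolding Psi by auto
    have plus: "eps i + eps j + a *\<^sub>R delta \<in> Psi_I n eps delta I"
      if ij: "i \<in> {1..n}" "j \<in> {1..n}" "i \<noteq> j" and a: "a = ?p i + ?p j + 2 * of_int k" for i j a and k :: int
    proof (cases "i \<in> I \<longleftrightarrow> j \<in> I")
      case True
      then have "a = 2 * of_int (if i \<in> I then k else k + 1) + 1" using a by simp
      then show ?thesis using P_plus_same[OF ij True] unfolding Psi by blast
    next
      case False
      then have a': "a = 2 * of_int (k + 1)" using a by auto
      show ?thesis
      proof (cases "i \<in> I")
        case True
        then show ?thesis using P_plus_mixed[of i j "k + 1"] False ij unfolding Psi a' by blast
      next
        case i: False
        then have "eps j + eps i + (2 * of_int (k + 1)) *\<^sub>R delta \<in> P"
          using False ij by (intro P_plus_mixed) auto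
        then show ?thesis unfolding Psi a' by (simp add: add.commute)
      qed
    qed
    have minus: "eps i - eps j + a *\<^sub>R delta \<in> Psi_I n eps delta I"
      if ij: "i \<in> {1..n}" "j \<in> {1..n}" "i \<noteq> j" and a: "a = ?p i - ?p j + 2 * of_int k" for i j a and k :: int
    proof (cases "i \<in> I \<longleftrightarrow> j \<in> I")
      case True
      then have "a = 2 * of_int k" using a by simp
      then show ?thesis using P_minus_same[OF ij True] unfolding Psi by blast
    next
      case False
      show ?thesis
      proof (cases "i \<in> I")
        case True
        then have "a = 2 * of_int (k - 1) + 1" using a False by simp
        then show ?thesis using P_minus_mixed[of i j "k - 1"] True False ij unfolding Psi by auto
      next
        case i: False
        then have a': "a = - (2 * of_int (- k - 1) + 1)" using a False by simp
        have "eps j - eps i + (2 * of_int (- k - 1) + 1) *\<^sub>R delta \<in> P"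
          using i False ij by (intro P_minus_mixed) auto
        then have "- (eps j - eps i + (2 * of_int (- k - 1) + 1) *\<^sub>R delta) \<in> Psi_I n eps delta I"
          unfolding Psi by blast
        then show ?thesis unfolding a' by (simp only: scaleR_minus_left) (simp add: algebra_simps)
      qed
    qed
    obtain k :: int where x: "x \<in> \<Phi>" and k: "shifted ?p x = of_nat 2 * of_int k"
      using \<open>x \<in> ?K\<close> unfolding congruent_roots_def by blast
    show ?thesis
      using x
    proof (cases rule: Phi_cases)
      case (short s i r)
      have eq: "of_int r + 1/2 = s * ?p i + 2 * of_int k"
        using k short by (simp add: shifted_def eps_unit)
      show ?thesis
      proof (cases "s = 1")
        case True
        then have "x = eps i + (2 * of_int k + ?p i) *\<^sub>R delta" unfolding short(3) eq by simp
        then show ?thesis using P_short[OF short(2)] unfolding Psi by blast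
      next
        case False
        then have s: "s = - 1" using short(1) by simp
        have "x = - (eps i + (2 * of_int (- k) + ?p i) *\<^sub>R delta)"
          unfolding short(3) eq s by (simp add: algebra_simps)
        then show ?thesis using P_short[OF short(2), of "- k"] unfolding Psi by blast
      qed
    next
      case (long s i r)
      have "2 * of_int r - 2 * s * ?p i = 2 * of_int k"
        using k long by (simp add: shifted_def eps_unit)
      then have "real_of_int (2 * (r - k)) = 2 * s * ?p i" by simp
      then have "real_of_int (2 * (r - k)) \<in> of_int ` {1, - 1, 3, - 3}" using long(1) by auto
      then have "2 * (r - k) \<in> {1, - 1, 3, - 3}" by (simp only: of_int_eq_iff image_iff) auto
      then have False by (elim insertE emptyE) presburger+
      then show ?thesis ..
    next
      case (intermediate s t i j r)
      have eq: "of_int r = s * ?p i + t * ?p j + 2 * of_int k"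
        using k intermediate by (simp add: shifted_def eps_unit)
      consider "s = 1" "t = 1" | "s = 1" "t = - 1" | "s = - 1" "t = 1" | "s = - 1" "t = - 1"
        using intermediate(1,2) by blast
      then show ?thesis
      proof cases
        case 1
        then show ?thesis using plus[of i j "of_int r" k] intermediate(3-6) eq by simp
      next
        case 2
        then show ?thesis using minus[of i j "of_int r" k] intermediate(3-6) eq by simp
      next
        case 3
        then have "x = eps j - eps i + of_int r *\<^sub>R delta" using intermediate(6) by simp
        then show ?thesis using minus[of j i "of_int r" k] intermediate(3-5) eq 3 by simp
      next
        case 4
        then have "x = - (eps i + eps j + (- of_int r) *\<^sub>R delta)"
          unfolding intermediate(6) by (simp add: algebra_simps)
        moreover have "eps i + eps j + (- of_int r) *\<^sub>R delta \<in> Psi_I n eps delta I"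
          by (rule plus[of i j _ "- k"]) (use intermediate(3-5) 4 eq in simp_all)
        ultimately show ?thesis using neg by metis
      qed
    qed
  qed
  ultimately show ?thesis by blast
qed

section \<open>The systems of odd prime period\<close>

lemma admissible_p_half: "admissible_p n form eps p \<Longrightarrow> i \<in> {1..n} \<Longrightarrow> p (eps i) - 1/2 \<in> \<int>"
  unfolding admissible_p_def Let_def by blast

text \<open>The witness is the restriction of a linear functional, so additivity and the compatibility with
  reflections are automatic and only integrality needs the hypothesis.\<close>

lemma admissible_offset:
  assumes p: "\<And>i. i \<in> {1..n} \<Longrightarrow> p i - 1/2 \<in> \<int>"
  shows "admissible_p n form eps (offset p)"
proof -
  let ?q = "offset p"
  have half: "?q u - 1/2 \<in> \<int>" if "u \<in> units" for u
    using p that by (rule offset_unit_half)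
  have "2 * ?q \<alpha> \<in> \<int>" if \<alpha>: "\<alpha> \<in> Gr_short n eps \<union> Gr_im n eps" for \<alpha>
    using \<alpha>
  proof
    assume "\<alpha> \<in> Gr_short n eps"
    then show ?thesis using half_integer_double[OF half] by blast
  next
    assume "\<alpha> \<in> Gr_im n eps"
    then obtain s i t j where st: "s \<in> signs" "i \<in> {1..n}" "t \<in> signs" "j \<in> {1..n}"
        "\<alpha> = s *\<^sub>R eps i + t *\<^sub>R eps j"
      unfolding Gr_im_def by blast
    then have "s *\<^sub>R eps i \<in> units" "t *\<^sub>R eps j \<in> units" unfolding Gr_short_def by blast+
    from half_integer_double[OF half[OF this(1)]] half_integer_double[OF half[OF this(2)]]
    show ?thesis unfolding st by (simp only: offset_simps distrib_left Ints_add)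
  qed
  moreover have "?q \<beta> - pairing form \<beta> \<alpha> * ?q \<alpha> = ?q (reflection form \<alpha> \<beta>)" for \<alpha> \<beta>
    by (simp add: reflection_def)
  moreover have "Z_linear_on (Gr_short n eps \<union> Gr_im n eps) ?q"
    unfolding Z_linear_on_def by (rule exI[of _ ?q]) simp
  ultimately show ?thesis
    unfolding admissible_p_def Let_def using p by simp
qed

text \<open>For a long root the functional takes the value \<open>2b - 2sp\<^sub>i\<close>, which is odd. Since \<open>m\<close> is odd, it is a
  multiple of \<open>m\<close> only if it is an odd multiple; this is the summand \<open>m\<close> in the long roots of \<open>Psi_p\<close>. Below, the sign
  \<open>s\<close> reappears as the integer \<open>e\<close>, because it has to be moved into integral coefficients.\<close>

lemma Psi_p_eq_congruent_roots:
  assumes p: "\<And>i. i \<in> {1..n} \<Longrightarrow> p (eps i) - 1/2 \<in> \<int>" and m: "odd m"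
  shows "Psi_p n eps delta p m = congruent_roots (shifted (\<lambda>i. p (eps i))) m"
    (is "_ = ?K")
proof (intro equalityI subsetI)
  let ?f = "shifted (\<lambda>i. p (eps i))"
  have unit: "s *\<^sub>R eps i \<in> units" if "s \<in> signs" "i \<in> {1..n}" for s i
    using that unfolding Gr_short_def by blast
  have half: "s * p (eps i) - 1/2 \<in> \<int>" if "s \<in> signs" "i \<in> {1..n}" for s i
    using offset_unit_half[of "\<lambda>i. p (eps i)", OF p unit[OF that]] that(2) by simp
  have f: "?f x = delta_coord x - offset (\<lambda>i. p (eps i)) x" for x by (simp add: shifted_def)
  have K: "x \<in> ?K" if "x \<in> \<Phi>" "?f x = of_nat m * of_int k" for x and k :: int
    using that unfolding congruent_roots_def by blast
  fix x assume "x \<in> Psi_p n eps delta p m"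
  then consider s i and r :: int where "s \<in> signs" "i \<in> {1..n}"
      "x = s *\<^sub>R (eps i + (p (eps i) + of_int r * of_nat m) *\<^sub>R delta)"
    | s i and r :: int where "s \<in> signs" "i \<in> {1..n}"
      "x = s *\<^sub>R (2 *\<^sub>R eps i + (2 * p (eps i) + of_nat m + 2 * of_int r * of_nat m) *\<^sub>R delta)"
    | s t i j and r :: int where "s \<in> signs" "t \<in> signs" "i \<in> {1..n}" "j \<in> {1..n}" "i \<noteq> j"
      "x = s *\<^sub>R eps i + t *\<^sub>R eps j + (s * p (eps i) + t * p (eps j) + of_int r * of_nat m) *\<^sub>R delta"
    unfolding Psi_p_def by (elim UnE CollectE exE conjE) (rule that; assumption)+
  then show "x \<in> ?K"
  proof cases
    case (1 s i r)
    define e :: int where "e = (if s = 1 then 1 else - 1)"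
    have e: "s = of_int e" using 1 by (auto simp: e_def)
    have x: "x = s *\<^sub>R eps i + (s * p (eps i) + of_int (e * r * int m)) *\<^sub>R delta"
      unfolding 1 by (simp add: algebra_simps e)
    have "(s * p (eps i) + of_int (e * r * int m)) - 1/2 \<in> \<int>"
      using Ints_add[OF half[OF 1(1,2)] Ints_of_int[of "e * r * int m"]] by (simp add: algebra_simps)
    then have "x \<in> \<Phi>" unfolding x using short_root_iff[OF unit[OF 1(1,2)]] by blast
    moreover have "?f x = of_nat m * of_int (e * r)"
      unfolding x f using 1(2) by (simp add: eps_unit)
    ultimately show ?thesis by (rule K)
  next
    case (2 s i r)
    define e :: int where "e = (if s = 1 then 1 else - 1)"
    have e: "s = of_int e" using 2 by (auto simp: e_def)
    obtain l where l: "m = 2 * l + 1" using m by (auto elim: oddE)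
    define b where "b = s * p (eps i) + of_int e * (of_nat m / 2 + of_int r * of_nat m)"
    have x: "x = 2 *\<^sub>R (s *\<^sub>R eps i) + (2 * b) *\<^sub>R delta"
      unfolding 2 b_def by (simp add: algebra_simps e)
    have "b - of_int (e * (int l + r * int m)) - 1/2 = (s * p (eps i) - 1/2) + of_int e / 2"
      unfolding b_def l by (simp add: algebra_simps field_simps)
    then have "b - of_int (e * (int l + r * int m)) = (s * p (eps i) - 1/2) + (of_int e + 1) / 2"
      by (simp add: field_simps)
    moreover have "(of_int e + 1) / 2 \<in> (\<int> :: real set)" by (simp add: e_def)
    ultimately have "b - of_int (e * (int l + r * int m)) \<in> \<int>" using half[OF 2(1,2)] by (simp only: Ints_add)
    then have "b \<in> \<int>" using Ints_add[OF _ Ints_of_int] by fastforce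
    then have "x \<in> \<Phi>" unfolding x using long_rootI unit[OF 2(1,2)] by blast
    moreover have "?f x = of_nat m * of_int (e * (1 + 2 * r))"
      unfolding x f b_def using 2(2) by (simp add: eps_unit e algebra_simps)
    ultimately show ?thesis by (rule K)
  next
    case (3 s t i j r)
    have "form (s *\<^sub>R eps i) (t *\<^sub>R eps j) = 0" using 3 by (simp add: eps_orthonormal)
    moreover have "s * p (eps i) + t * p (eps j) + of_int r * of_nat m \<in> \<int>"
      using Ints_add[OF half_integer_add[OF half[OF 3(1,3)] half[OF 3(2,4)]] Ints_of_int[of "r * int m"]]
      by simp
    ultimately have "x \<in> \<Phi>" unfolding 3 using unit 3(1-4) by (intro intermediate_rootI) simp_all
    moreover have "?f x = of_nat m * of_int r" unfolding 3 f using 3(3,4) by (simp add: eps_unit)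
    ultimately show ?thesis by (rule K)
  qed
next
  let ?f = "shifted (\<lambda>i. p (eps i))"
  have f: "?f x = delta_coord x - offset (\<lambda>i. p (eps i)) x" for x by (simp add: shifted_def)
  fix x assume "x \<in> ?K"
  then obtain k :: int where x: "x \<in> \<Phi>" and k: "?f x = of_nat m * of_int k"
    unfolding congruent_roots_def by blast
  show "x \<in> Psi_p n eps delta p m"
    using x
  proof (cases rule: Phi_cases)
    case (short s i r)
    define e :: int where "e = (if s = 1 then 1 else - 1)"
    have e: "s = of_int e" "e * e = 1" using short by (auto simp: e_def)
    have "of_int r + 1/2 = s * p (eps i) + of_nat m * of_int k"
      using k short by (simp add: f eps_unit)
    also have "of_nat m * of_int k = of_int (e * e) * of_nat m * (of_int k :: real)" using e by simp
    finally have "x = s *\<^sub>R (eps i + (p (eps i) + of_int (e * k) * of_nat m) *\<^sub>R delta)"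
      unfolding short(3) by (simp add: e(1) algebra_simps)
    then show ?thesis unfolding Psi_p_def using short(1,2) by blast
  next
    case (long s i r)
    define e :: int where "e = (if s = 1 then 1 else - 1)"
    have e: "s = of_int e" "e * e = 1" "odd e" using long by (auto simp: e_def)
    have eq: "2 * of_int r = 2 * s * p (eps i) + of_nat m * of_int k"
      using k long by (simp add: f eps_unit)
    obtain h :: int where h: "p (eps i) = of_int h + 1/2"
      using p[OF long(2)] by (auto elim!: Ints_cases simp: algebra_simps)
    have "real_of_int (2 * r) = of_int (e * (2 * h + 1) + int m * k)"
      using eq unfolding h e(1) by (simp add: algebra_simps)
    then have "2 * r = e * (2 * h + 1) + int m * k" by (simp only: of_int_eq_iff)
    then have "even (e * (2 * h + 1) + int m * k)" by (metis dvd_triv_left)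
    then have "odd (e * k)" using e(3) by auto
    then obtain l where l: "e * k = 2 * l + 1" by (rule oddE)
    have "k = e * (2 * l + 1)" using e(2) l by (metis mult.assoc mult_1)
    then have "x = s *\<^sub>R (2 *\<^sub>R eps i + (2 * p (eps i) + of_nat m + 2 * of_int l * of_nat m) *\<^sub>R delta)"
      unfolding long(3) eq by (simp add: e(1) algebra_simps)
    then show ?thesis unfolding Psi_p_def using long(1,2) by blast
  next
    case (intermediate s t i j r)
    have "of_int r = s * p (eps i) + t * p (eps j) + of_int k * of_nat m"
      using k intermediate by (simp add: f eps_unit algebra_simps)
    then have "x = s *\<^sub>R eps i + t *\<^sub>R eps j + (s * p (eps i) + t * p (eps j) + of_int k * of_nat m) *\<^sub>R delta"
      using intermediate(6) by simp
    then show ?thesis unfolding Psi_p_def using intermediate(1-5) by blast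
  qed
qed

text \<open>Only the base points modulo 2 matter, so each may be replaced by \<open>1/2\<close> or \<open>3/2\<close>.\<close>

lemma congruent_roots_two_eq_Psi_I:
  assumes n: "n \<ge> 2" and p: "\<And>i. i \<in> {1..n} \<Longrightarrow> p i - 1/2 \<in> \<int>"
  shows "\<exists>I\<subseteq>{1..n}. congruent_roots (shifted p) 2 = Psi_I n eps delta I"
proof -
  let ?K = "congruent_roots (shifted p) 2"
  define I where "I = {i \<in> {1..n}. \<exists>k::int. p i - 1/2 = 2 * of_int k}"
  have mem: "eps i + (half_residue I i + 2 * of_int l) *\<^sub>R delta \<in> ?K" if i: "i \<in> {1..n}" for i and l :: int
  proof -
    obtain h :: int where h: "p i - 1/2 = of_int h" using p[OF i] by (auto elim: Ints_cases)
    have "\<exists>k::int. half_residue I i - p i = 2 * of_int k"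
    proof (cases "even h")
      case True
      then obtain k where k: "h = 2 * k" by (rule evenE)
      then have "p i - 1/2 = 2 * of_int k" using h by simp
      moreover from this have "i \<in> I" using i unfolding I_def by blast
      ultimately have "half_residue I i - p i = 2 * of_int (- k)" by simp
      then show ?thesis by blast
    next
      case False
      then obtain k where k: "h = 2 * k + 1" by (rule oddE)
      have "i \<notin> I"
      proof
        assume "i \<in> I"
        then obtain k' :: int where "p i - 1/2 = 2 * of_int k'" unfolding I_def by blast
        then have "h = 2 * k'" using h by linarith
        then show False using False by simp
      qed
      then have "half_residue I i - p i = 2 * of_int (- k)" using h k by simp
      then show ?thesis by blast
    qed
    then obtain k :: int where k: "half_residue I i - p i = 2 * of_int k" by blast
    have "(half_residue I i + 2 * of_int l) - 1/2 \<in> \<int>"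
      by (simp add: algebra_simps)
    then have "eps i + (half_residue I i + 2 * of_int l) *\<^sub>R delta \<in> \<Phi>"
      using short_root_iff[OF eps_unit[OF i]] by blast
    moreover have "shifted p (eps i + (half_residue I i + 2 * of_int l) *\<^sub>R delta) = of_nat 2 * of_int (k + l)"
      using i k by simp
    ultimately show ?thesis unfolding congruent_roots_def by blast
  qed
  have "?K = congruent_roots (shifted (half_residue I)) 2"
  proof (rule closed_between_prime_and_all[OF n])
    show "closed_subroot_system form \<Phi> ?K" "?K \<noteq> \<Phi>"
      using congruent_roots_shifted_closed_proper[of p 2, OF p] n by auto
    show "eps i + half_residue I i *\<^sub>R delta \<in> ?K" if "i \<in> {1..n}" for i
      using mem[OF that, of 0] by simp
    show "eps 1 + (half_residue I 1 + of_nat 2) *\<^sub>R delta \<in> ?K"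
      using mem[of 1 1] n by simp
  qed simp
  moreover have "I \<subseteq> {1..n}" by (auto simp: I_def)
  ultimately show ?thesis using Psi_I_eq_congruent_roots by metis
qed

section \<open>The classification\<close>

lemma maximal_cases:
  assumes n: "n \<ge> 2" and \<Psi>: "maximal_closed_subroot_system form \<Phi> \<Psi>"
  shows "(\<exists>J. J \<subset> {1..n} \<and> \<Psi> = lift n eps delta (A_J n eps J)) \<or>
    (\<exists>I. I \<subseteq> {1..n} \<and> \<Psi> = Psi_I n eps delta I) \<or>
    (\<exists>q p. prime q \<and> odd q \<and> admissible_p n form eps p \<and> \<Psi> = Psi_p n eps delta p q)"
proof -
  have closed: "closed_subroot_system form \<Phi> \<Psi>" and proper: "\<Psi> \<noteq> \<Phi>"
    using \<Psi> unfolding maximal_closed_subroot_system_def by auto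
  have sub: "short_directions \<Psi> \<subseteq> {1..n}" by (auto simp: short_directions_def)
  show ?thesis
  proof (cases "short_directions \<Psi> = {1..n}")
    case False
    then have J: "short_directions \<Psi> \<subset> {1..n}" using sub by blast
    have "\<Psi> = lift n eps delta (A_J n eps (short_directions \<Psi>))"
      using maximal_eqI[OF \<Psi> lift_closed_proper(1)[OF J] closed_subset_lift[OF closed]
        lift_closed_proper(2)[OF J]] .
    then show ?thesis using J by blast
  next
    case True
    then have "\<forall>i\<in>{1..n}. \<exists>a. eps i + a *\<^sub>R delta \<in> \<Psi>"
      unfolding short_directions_def by blast
    then obtain p where p: "\<And>i. i \<in> {1..n} \<Longrightarrow> eps i + p i *\<^sub>R delta \<in> \<Psi>" by metis
    then obtain m where m: "\<Psi> = congruent_roots (shifted p) m"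
      using closed_with_all_short_directions[OF n closed] by blast
    have half: "p i - 1/2 \<in> \<int>" if "i \<in> {1..n}" for i
      using p[OF that] short_root_iff[OF eps_unit[OF that]] closedD(1)[OF closed] by blast
    have "m \<noteq> 1" using proper m congruent_roots_shifted_one[of p, OF half] by metis
    then obtain q where q: "prime q" "q dvd m" by (metis prime_factor_nat)
    have q1: "q \<noteq> 1" "n \<ge> 1" using q n by auto
    obtain m' where m': "m = q * m'" using q(2) by (rule dvdE)
    have "\<Psi> \<subseteq> congruent_roots (shifted p) q"
    proof
      fix x assume "x \<in> \<Psi>"
      then obtain k :: int where "x \<in> \<Phi>" "shifted p x = of_nat m * of_int k"
        unfolding m congruent_roots_def by blast
      then have "x \<in> \<Phi>" "shifted p x = of_nat q * of_int (int m' * k)" using m' by simp_all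
      then show "x \<in> congruent_roots (shifted p) q"
        unfolding congruent_roots_def by blast
    qed
    then have \<Psi>_q: "\<Psi> = congruent_roots (shifted p) q"
      using maximal_eqI[OF \<Psi>] congruent_roots_shifted_closed_proper[of p q, OF half q1(2,1)] by blast
    show ?thesis
    proof (cases "q = 2")
      case True
      then show ?thesis using congruent_roots_two_eq_Psi_I[of p, OF n half] \<Psi>_q by metis
    next
      case False
      then have odd: "odd q" using q(1) primes_dvd_imp_eq two_is_prime_nat by blast
      let ?p = "offset p"
      have "?p (eps i) - 1/2 \<in> \<int>" if "i \<in> {1..n}" for i using half[OF that] that by simp
      then have "Psi_p n eps delta ?p q = congruent_roots (shifted (\<lambda>i. ?p (eps i))) q"
        using odd by (rule Psi_p_eq_congruent_roots)
      moreover have "offset (\<lambda>i. ?p (eps i)) x = ?p x" for x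
        unfolding offset_def[of _ x] by (rule sum.cong) simp_all
      then have "shifted (\<lambda>i. ?p (eps i)) = shifted p" unfolding shifted_def fun_eq_iff by simp
      ultimately have "\<Psi> = Psi_p n eps delta ?p q" using \<Psi>_q by simp
      then show ?thesis using q(1) odd admissible_offset[of p, OF half] by blast
    qed
  qed
qed

end

theorem theorem10p3p1:
  fixes n :: nat
    and form :: "'v::real_vector \<Rightarrow> 'v \<Rightarrow> real"
    and eps :: "nat \<Rightarrow> 'v"
    and delta :: 'v
  assumes "affine_setting n form eps delta"
    and "n \<ge> 2"
  shows
    "(\<forall>\<Psi>. maximal_closed_subroot_system form (Phi n eps delta) \<Psi> \<longrightarrow>
        (\<exists>J. J \<subset> {1..n} \<and> \<Psi> = lift n eps delta (A_J n eps J)) \<or>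
        (\<exists>I. I \<subseteq> {1..n} \<and> \<Psi> = Psi_I n eps delta I) \<or>
        (\<exists>n\<^sub>s p. prime n\<^sub>s \<and> odd n\<^sub>s \<and> admissible_p n form eps p \<and> \<Psi> = Psi_p n eps delta p n\<^sub>s)) \<and>
     (\<forall>J. J \<subset> {1..n} \<longrightarrow>
        maximal_closed_subroot_system form (Phi n eps delta) (lift n eps delta (A_J n eps J))) \<and>
     (\<forall>I. I \<subseteq> {1..n} \<longrightarrow>
        maximal_closed_subroot_system form (Phi n eps delta) (Psi_I n eps delta I)) \<and>
     (\<forall>n\<^sub>s p. prime n\<^sub>s \<and> odd n\<^sub>s \<and> admissible_p n form eps p \<longrightarrow>
        maximal_closed_subroot_system form (Phi n eps delta) (Psi_p n eps delta p n\<^sub>s))"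
proof -
  interpret affine_setting n form eps delta by fact
  have "maximal_closed_subroot_system form (Phi n eps delta) (Psi_I n eps delta I)"
    if "I \<subseteq> {1..n}" for I
    unfolding Psi_I_eq_congruent_roots[OF that]
    by (intro maximal_congruent_roots_prime assms half_residue_half two_is_prime_nat)
  moreover have "maximal_closed_subroot_system form (Phi n eps delta) (Psi_p n eps delta p q)"
    if "prime q" "odd q" "admissible_p n form eps p" for p q
    using Psi_p_eq_congruent_roots[of p q, OF admissible_p_half[OF that(3)] that(2)]
      maximal_congruent_roots_prime[of "\<lambda>i. p (eps i)" q, OF assms(2) admissible_p_half[OF that(3)] that(1)]
    by simp
  ultimately show ?thesis
    using maximal_cases[OF assms(2)] maximal_lift[OF assms(2)] by (intro conjI allI impI) simp_all
qed

end
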